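(* Let $W_{\psi,\varphi,\max}$ be the maximal weighted composition operator on $\mathcal F^2$ induced by two entire functions $\psi,\varphi$ with $\psi\not\equiv0$. Then the following assertions are equivalent. (1) The operator $W_{\psi,\varphi,\max}$ is Hermitian. (2) The operator $W_{\psi,\varphi,\max}$ is densely defined and satisfies $W_{\psi,\varphi,\max}^*\preceq W_{\psi,\varphi,\max}$. (3) There are $A\in\mathbb R$, $C\in\mathbb R\setminus\{0\}$ and $B\in\mathbb C$ such that $\varphi(z)=Az+B$ and $\psi(z)=Ce^{\overline Bz}$.
   Context: The Fock space $\mathcal F^2$ is the Hilbert space of entire functions on $\mathbb C$ that are square integrable with respect to $\frac1\pi e^{-|z|^2}\,dV(z)$ ($dV$ is Lebesgue measure on $\mathbb C$), with inner product $\langle f,g\rangle=\frac1\pi\int_{\mathbb C}f(z)\overline{g(z)}e^{-|z|^2}\,dV(z)$. For entire functions $\psi,\varphi$, put $E(\psi,\varphi)f=\psi\cdot (f\circ\varphi)$. The maximal weighted composition operator $W_{\psi,\varphi,\max}$ has domain $\{f\in\mathcal F^2: E(\psi,\varphi)f\in\mathcal F^2\}$ and acts by $W_{\psi,\varphi,\max}f=E(\psi,\varphi)f$. $F\preceq G$ means that $G$ is an extension of $F$. A closed densely defined operator $T$ is Hermitian if $T=T^*$ (including equality of domains). *)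

theory Defs
  imports "HOL-Complex_Analysis.Complex_Analysis"
begin

definition fock_measure :: "complex measure" where
  "fock_measure = density lborel (\<lambda>z. ennreal (exp (- (cmod z)\<^sup>2) / pi))"

definition fock_space :: "(complex \<Rightarrow> complex) set" where
  "fock_space = {f. f holomorphic_on UNIV \<and> integrable fock_measure (\<lambda>z. (cmod (f z))\<^sup>2)}"

definition fock_inner :: "(complex \<Rightarrow> complex) \<Rightarrow> (complex \<Rightarrow> complex) \<Rightarrow> complex" where
  "fock_inner f g = (LINT z|fock_measure. f z * cnj (g z))"

definition fock_norm :: "(complex \<Rightarrow> complex) \<Rightarrow> real" where
  "fock_norm f = sqrt (Re (fock_inner f f))"

text \<open>An unbounded operator is a partial map \<open>T\<close>: its domain is \<open>dom T\<close>, extension of operators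
  is \<open>\<subseteq>\<^sub>m\<close>, and equality of operators includes equality of domains.\<close>

type_synonym partial_op = "(complex \<Rightarrow> complex) \<Rightarrow> (complex \<Rightarrow> complex) option"

definition fock_operator :: "partial_op \<Rightarrow> bool" where
  "fock_operator T \<longleftrightarrow>
     dom T \<subseteq> fock_space \<and> ran T \<subseteq> fock_space \<and> T (\<lambda>_. 0) = Some (\<lambda>_. 0) \<and>
     (\<forall>f g Tf Tg. \<forall>a b :: complex. T f = Some Tf \<longrightarrow> T g = Some Tg \<longrightarrow>
        T (\<lambda>z. a * f z + b * g z) = Some (\<lambda>z. a * Tf z + b * Tg z))"

definition densely_defined :: "partial_op \<Rightarrow> bool" where
  "densely_defined T \<longleftrightarrow>
     (\<forall>f\<in>fock_space. \<forall>e>0. \<exists>g\<in>dom T. fock_norm (\<lambda>z. f z - g z) < e)"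

definition closed_op :: "partial_op \<Rightarrow> bool" where
  "closed_op T \<longleftrightarrow>
     (\<forall>F G. \<forall>f\<in>fock_space. \<forall>g\<in>fock_space.
        (\<forall>n::nat. T (F n) = Some (G n)) \<longrightarrow>
        (\<lambda>n. fock_norm (\<lambda>z. F n z - f z)) \<longlonglongrightarrow> 0 \<longrightarrow>
        (\<lambda>n. fock_norm (\<lambda>z. G n z - g z)) \<longlonglongrightarrow> 0 \<longrightarrow>
        T f = Some g)"

definition adjoint_pair :: "partial_op \<Rightarrow> (complex \<Rightarrow> complex) \<Rightarrow> (complex \<Rightarrow> complex) \<Rightarrow> bool" where
  "adjoint_pair T g h \<longleftrightarrow>
     g \<in> fock_space \<and> h \<in> fock_space \<and>
     (\<forall>f Tf. T f = Some Tf \<longrightarrow> fock_inner Tf g = fock_inner f h)"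

text \<open>The Hilbert space adjoint. The vector \<open>h\<close> is unique when \<open>T\<close> is densely defined; the
  definition is meaningful only in that case.\<close>

definition op_adjoint :: "partial_op \<Rightarrow> partial_op" where
  "op_adjoint T g =
     (if \<exists>h. adjoint_pair T g h then Some (THE h. adjoint_pair T g h) else None)"

definition hermitian_op :: "partial_op \<Rightarrow> bool" where
  "hermitian_op T \<longleftrightarrow>
     fock_operator T \<and> closed_op T \<and> densely_defined T \<and> T = op_adjoint T"

definition weighted_comp ::
  "(complex \<Rightarrow> complex) \<Rightarrow> (complex \<Rightarrow> complex) \<Rightarrow> (complex \<Rightarrow> complex) \<Rightarrow> complex \<Rightarrow> complex" where
  "weighted_comp \<psi> \<phi> f = (\<lambda>z. \<psi> z * f (\<phi> z))"

definition W_max :: "(complex \<Rightarrow> complex) \<Rightarrow> (complex \<Rightarrow> complex) \<Rightarrow> partial_op" where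
  "W_max \<psi> \<phi> f =
     (if f \<in> fock_space \<and> weighted_comp \<psi> \<phi> f \<in> fock_space
      then Some (weighted_comp \<psi> \<phi> f) else None)"

end

theory Submission
  imports Defs "HOL-Probability.Distributions" "HOL-Real_Asymp.Real_Asymp"
begin

text \<open>
  The kernels \<open>K\<^sub>w(z) = exp (cnj w * z)\<close> reproduce point evaluations: averaging over circles gives
  the mean value property \<open>\<langle>g, 1\<rangle> = g(0)\<close>, and a translation of the Gaussian moves it to any point.

  If \<open>W\<close> denotes the maximal operator, then \<open>W\<^sup>* K\<^sub>w = cnj (\<psi> w) K\<^bsub>\<phi> w\<^esub>\<close>, so that \<open>W\<^sup>* \<subseteq> W\<close> forces
  \<open>\<psi>(z) exp (cnj w * \<phi>(z)) = cnj (\<psi>(w)) exp (cnj (\<phi>(w)) * z)\<close>; taking \<open>w = 0\<close> and \<open>w = 1\<close> yields the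
  explicit form of the symbols.

  Conversely, testing an adjoint pair against kernels shows \<open>W\<^sup>* \<subseteq> W\<close>, and polynomials are dense
  and lie in the domain. What remains is the symmetry of \<open>W\<close>. For \<open>\<bar>A\<bar> < 1\<close> it follows by inserting
  the reproducing formula and exchanging integrals. For \<open>\<bar>A\<bar> = 1\<close> one composes with the dilations
  \<open>f(z) \<mapsto> f(r z)\<close> and lets \<open>r\<close> tend to 1. For \<open>\<bar>A\<bar> > 1\<close> the operator is the inverse of one with
  parameter \<open>1 / A\<close>.
\<close>

section \<open>Gaussian measure on the complex plane\<close>

text \<open>The integrand is \<open>sqrt (pi / c)\<close> times the normal density of variance
  \<open>1 / (2 * c)\<close>, and that density has total mass one.\<close>

lemma nn_integral_gaussian_real:
  fixes c :: real
  assumes "c > 0"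
  shows "(\<integral>\<^sup>+x. ennreal (exp (- c * x\<^sup>2)) \<partial>lborel) = ennreal (sqrt (pi / c))"
proof -
  define s where "s = 1 / sqrt (2 * c)"
  have s: "s > 0" "2 * s\<^sup>2 = 1 / c"
    using assms by (simp_all add: s_def power_divide)
  have eq: "exp (- c * x\<^sup>2) = sqrt (pi / c) * normal_density 0 s x" for x
  proof -
    have "2 * pi * s\<^sup>2 = pi / c"
      using s(2) by (simp add: mult.assoc mult.left_commute)
    moreover have "x\<^sup>2 / (2 * s\<^sup>2) = c * x\<^sup>2"
      using s(2) by simp
    ultimately show ?thesis
      using assms by (simp add: normal_density_def)
  qed
  interpret prob_space "density lborel (normal_density 0 s)"
    by (rule prob_space_normal_density) fact
  have "(\<integral>\<^sup>+x. ennreal (normal_density 0 s x) \<partial>lborel) = 1"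
    using emeasure_space_1 by (simp add: emeasure_density)
  then show ?thesis
    unfolding eq using assms by (simp add: ennreal_mult nn_integral_cmult)
qed

text \<open>The squared modulus is the sum of the squared coordinates, so the integrand is a product
  over \<open>Basis\<close> and the integral factors into two real Gaussians.\<close>

lemma nn_integral_gaussian_complex:
  assumes "c > 0"
  shows "(\<integral>\<^sup>+z. ennreal (exp (- c * (cmod z)\<^sup>2)) \<partial>lborel) = ennreal (pi / c)"
proof -
  have ne: "\<i> \<noteq> 1" by (simp add: complex_eq_iff)
  have "(\<integral>\<^sup>+z. ennreal (exp (- c * (cmod z)\<^sup>2)) \<partial>lborel)
      = (\<integral>\<^sup>+(z::complex). (\<Prod>b\<in>Basis. ennreal (exp (- c * (z \<bullet> b)\<^sup>2))) \<partial>lborel)"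
    by (intro nn_integral_cong)
       (simp add: ne Basis_complex_def cmod_def ennreal_mult[symmetric] exp_add[symmetric] algebra_simps)
  also have "\<dots> = (\<Prod>b\<in>(Basis::complex set). \<integral>\<^sup>+x. ennreal (exp (- c * x\<^sup>2)) \<partial>lborel)"
    by (rule nn_integral_lborel_prod) auto
  also have "\<dots> = ennreal (pi / c)"
    using ne assms by (simp add: nn_integral_gaussian_real[simplified] Basis_complex_def ennreal_mult[symmetric])
  finally show ?thesis .
qed

lemma nn_integral_lborel_translate:
  fixes t :: "'a :: euclidean_space"
  assumes [measurable]: "f \<in> borel_measurable borel"
  shows "(\<integral>\<^sup>+z. f (t + z) \<partial>lborel) = (\<integral>\<^sup>+z. f z \<partial>lborel)"
  using nn_integral_distr[of "(+) t" lborel borel f] by (simp add: lborel_distr_plus)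

text \<open>The argument for uniqueness of Haar measure, tested against a Gaussian: it is a radial
  function with finite positive integral.\<close>

lemma nn_integral_lborel_rotate:
  fixes w :: complex
  assumes w: "cmod w = 1" and [measurable]: "g \<in> borel_measurable borel"
  shows "(\<integral>\<^sup>+z. g (w * z) \<partial>lborel) = (\<integral>\<^sup>+z. g z \<partial>lborel)"
proof -
  define k where "k z = ennreal (exp (- 1 * (cmod z)\<^sup>2))" for z :: complex
  have [measurable]: "k \<in> borel_measurable borel"
    unfolding k_def by measurable
  have k_rot: "k (- (w * z)) = k z" for z
    using w by (simp add: k_def norm_mult)
  have ww: "w * (cnj w * z) = z" for z
    using w by (simp add: mult.assoc[symmetric] complex_norm_square[symmetric])
  have k_int: "(\<integral>\<^sup>+z. k z \<partial>lborel) = ennreal pi"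
    unfolding k_def by (subst nn_integral_gaussian_complex) auto
  have "ennreal pi * (\<integral>\<^sup>+y. g (w * y) \<partial>lborel) = (\<integral>\<^sup>+x. k x * (\<integral>\<^sup>+y. g (w * y) \<partial>lborel) \<partial>lborel)"
    by (simp add: nn_integral_multc k_int)
  also have "\<dots> = (\<integral>\<^sup>+x. (\<integral>\<^sup>+y. k x * g (w * y) \<partial>lborel) \<partial>lborel)"
    by (simp add: nn_integral_cmult)
  \<comment> \<open>Translating \<open>y\<close> by \<open>cnj w * x\<close>, the preimage of
    \<open>x\<close> under the rotation, moves \<open>x\<close> into the argument of
    \<open>g\<close>.\<close>
  also have "\<dots> = (\<integral>\<^sup>+x. (\<integral>\<^sup>+y. k x * g (w * (cnj w * x + y)) \<partial>lborel) \<partial>lborel)"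
    by (intro nn_integral_cong nn_integral_lborel_translate[symmetric]) measurable
  also have "\<dots> = (\<integral>\<^sup>+x. (\<integral>\<^sup>+y. k x * g (x + w * y) \<partial>lborel) \<partial>lborel)"
    by (simp add: distrib_left ww)
  also have "\<dots> = (\<integral>\<^sup>+y. (\<integral>\<^sup>+x. k x * g (x + w * y) \<partial>lborel) \<partial>lborel)"
    by (rule lborel_pair.Fubini') measurable
  also have "\<dots> = (\<integral>\<^sup>+y. (\<integral>\<^sup>+x. k (- (w * y) + x) * g (- (w * y) + x + w * y) \<partial>lborel) \<partial>lborel)"
    by (intro nn_integral_cong nn_integral_lborel_translate[symmetric]) measurable
  also have "\<dots> = (\<integral>\<^sup>+y. (\<integral>\<^sup>+x. k (- (w * y) + x) * g x \<partial>lborel) \<partial>lborel)"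
    by simp
  also have "\<dots> = (\<integral>\<^sup>+x. (\<integral>\<^sup>+y. k (- (w * y) + x) * g x \<partial>lborel) \<partial>lborel)"
    by (rule lborel_pair.Fubini') measurable
  \<comment> \<open>The same translation removes \<open>x\<close> from the argument of
    \<open>k\<close>, leaving \<open>k (- (w * y))\<close>, where radiality absorbs the
    rotation.\<close>
  also have "\<dots> = (\<integral>\<^sup>+x. (\<integral>\<^sup>+y. k (- (w * (cnj w * x + y)) + x) * g x \<partial>lborel) \<partial>lborel)"
    by (intro nn_integral_cong nn_integral_lborel_translate[symmetric]) measurable
  also have "\<dots> = (\<integral>\<^sup>+x. (\<integral>\<^sup>+y. k y * g x \<partial>lborel) \<partial>lborel)"
    by (simp add: distrib_left ww k_rot)
  also have "\<dots> = ennreal pi * (\<integral>\<^sup>+y. g y \<partial>lborel)"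
    by (simp add: nn_integral_multc nn_integral_cmult k_int)
  finally show ?thesis
    by (simp add: ennreal_mult_cancel_left)
qed

section \<open>The Fock measure: total mass, rotation invariance, integrable Gaussians\<close>

lemma sets_fock_measure [measurable_cong, simp]: "sets fock_measure = sets borel"
  and space_fock_measure [simp]: "space fock_measure = UNIV"
  by (simp_all add: fock_measure_def)

lemma prob_space_fock_measure: "prob_space fock_measure"
proof
  have "(\<integral>\<^sup>+z. ennreal (exp (- (cmod z)\<^sup>2) / pi) \<partial>lborel)
      = (\<integral>\<^sup>+z. ennreal (1 / pi) * ennreal (exp (- 1 * (cmod z)\<^sup>2)) \<partial>lborel)"
    by (intro nn_integral_cong) (simp add: ennreal_mult[symmetric])
  also have "\<dots> = ennreal (1 / pi) * ennreal pi"
    by (subst nn_integral_cmult, simp, subst nn_integral_gaussian_complex) auto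
  also have "\<dots> = 1"
    by (simp add: ennreal_mult[symmetric])
  finally show "emeasure fock_measure (space fock_measure) = 1"
    by (simp add: fock_measure_def emeasure_density)
qed

interpretation fock: prob_space fock_measure
  by (rule prob_space_fock_measure)

interpretation fock_pair: pair_sigma_finite fock_measure fock_measure ..

lemma nn_integral_fock:
  assumes [measurable]: "f \<in> borel_measurable borel"
  shows "(\<integral>\<^sup>+z. f z \<partial>fock_measure) = (\<integral>\<^sup>+z. ennreal (exp (- (cmod z)\<^sup>2) / pi) * f z \<partial>lborel)"
  unfolding fock_measure_def by (rule nn_integral_density) auto

text \<open>The density depends on \<open>cmod z\<close> only, so the rotation invariance of
  Lebesgue measure carries over.\<close>

lemma distr_fock_rotate:
  assumes "cmod w = 1"
  shows "distr fock_measure borel ((*) w) = fock_measure"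
proof (rule measure_eqI)
  fix A assume "A \<in> sets (distr fock_measure borel ((*) w))"
  then have [measurable]: "A \<in> sets borel" by simp
  have "emeasure (distr fock_measure borel ((*) w)) A = (\<integral>\<^sup>+z. indicator A z \<partial>distr fock_measure borel ((*) w))"
    by simp
  also have "\<dots> = (\<integral>\<^sup>+z. indicator A (w * z) \<partial>fock_measure)"
    by (rule nn_integral_distr) measurable
  also have "\<dots> = (\<integral>\<^sup>+z. ennreal (exp (- (cmod (w * z))\<^sup>2) / pi) * indicator A (w * z) \<partial>lborel)"
    using assms by (subst nn_integral_fock) (auto simp: norm_mult)
  also have "\<dots> = (\<integral>\<^sup>+z. ennreal (exp (- (cmod z)\<^sup>2) / pi) * indicator A z \<partial>lborel)"
    using assms by (rule nn_integral_lborel_rotate) measurable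
  also have "\<dots> = emeasure fock_measure A"
    by (simp add: nn_integral_fock[symmetric])
  finally show "emeasure (distr fock_measure borel ((*) w)) A = emeasure fock_measure A" .
qed simp

lemma integrable_fock_iff:
  fixes f :: "complex \<Rightarrow> 'b :: {banach, second_countable_topology}"
  assumes "f \<in> borel_measurable borel"
  shows "integrable fock_measure f \<longleftrightarrow> integrable lborel (\<lambda>z. (exp (- (cmod z)\<^sup>2) / pi) *\<^sub>R f z)"
  unfolding fock_measure_def using assms by (intro integrable_density) auto

lemma integral_fock:
  fixes f :: "complex \<Rightarrow> 'b :: {banach, second_countable_topology}"
  assumes "f \<in> borel_measurable borel"
  shows "(\<integral>z. f z \<partial>fock_measure) = (\<integral>z. (exp (- (cmod z)\<^sup>2) / pi) *\<^sub>R f z \<partial>lborel)"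
  unfolding fock_measure_def using assms by (intro integral_density) auto

text \<open>Multiplied by the density, the function becomes a Gaussian with rate
  \<open>1 - c > 0\<close>.\<close>

lemma integrable_fock_gaussian:
  assumes "c < 1"
  shows "integrable fock_measure (\<lambda>z. exp (c * (cmod z)\<^sup>2))"
proof (rule integrableI_nonneg)
  have "(\<integral>\<^sup>+z. ennreal (exp (c * (cmod z)\<^sup>2)) \<partial>fock_measure)
      = (\<integral>\<^sup>+z. ennreal (1 / pi) * ennreal (exp (- (1 - c) * (cmod z)\<^sup>2)) \<partial>lborel)"
    by (subst nn_integral_fock)
       (auto intro!: nn_integral_cong simp: ennreal_mult[symmetric] exp_add[symmetric] algebra_simps)
  also have "\<dots> = ennreal (1 / pi) * ennreal (pi / (1 - c))"
    using assms by (subst nn_integral_cmult, simp, subst nn_integral_gaussian_complex) auto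
  also have "\<dots> < \<infinity>"
    by (simp add: ennreal_mult_less_top)
  finally show "(\<integral>\<^sup>+z. ennreal (exp (c * (cmod z)\<^sup>2)) \<partial>fock_measure) < \<infinity>" .
qed auto

section \<open>Entire functions and the mean value property\<close>

lemma borel_measurable_entire [measurable_dest]:
  assumes "f holomorphic_on UNIV"
  shows "f \<in> borel_measurable borel"
  using assms by (intro borel_measurable_continuous_onI holomorphic_on_imp_continuous_on)

lemma entire_compose:
  assumes "f holomorphic_on UNIV" "g holomorphic_on UNIV"
  shows "(\<lambda>z. f (g z)) holomorphic_on UNIV"
  using holomorphic_on_compose_gen[of g UNIV f UNIV] assms by (simp add: o_def)

text \<open>Cauchy's integral formula at \<open>0\<close> for \<open>u \<mapsto> g (u * z)\<close>
  on the unit circle: the derivative of the parametrization cancels the denominator up to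
  \<open>2 \<pi> \<i>\<close>. The parameter interval is given as a probability space, ready for the
  exchange of integrals with the Fock measure.\<close>

lemma circle_mean_value:
  assumes "g holomorphic_on UNIV"
  shows "(\<integral>t. g (exp (2 * of_real pi * \<i> * of_real t) * z) \<partial>restrict_space lborel {0..1}) = g 0"
proof -
  define h where "h u = g (u * z)" for u
  define e where "e t = exp (2 * of_real pi * \<i> * of_real t)" for t :: real
  have h: "h holomorphic_on UNIV"
    unfolding h_def by (intro entire_compose[OF assms] holomorphic_intros)
  have "((\<lambda>u. h u / (u - 0)) has_contour_integral (2 * of_real pi * \<i> * h 0)) (circlepath 0 1)"
    using h by (intro Cauchy_integral_circlepath_simple) (auto intro: holomorphic_on_subset)
  then have "((\<lambda>t. h (e t) / e t * (2 * of_real pi * \<i> * e t))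
      has_integral (2 * of_real pi * \<i> * h 0)) {0..1}"
    unfolding has_contour_integral_def e_def
    by (rule has_integral_eq[rotated]) (simp add: vector_derivative_circlepath01, simp add: circlepath)
  then have "((\<lambda>t. 2 * of_real pi * \<i> * h (e t)) has_integral (2 * of_real pi * \<i> * h 0)) {0..1}"
    by (simp add: e_def mult_ac)
  from has_integral_mult_right[OF this, of "1 / (2 * of_real pi * \<i>)"]
  have *: "((\<lambda>t. h (e t)) has_integral h 0) {0..1}"
    by simp
  have "continuous_on {0..1} (\<lambda>t. h (e t))"
    unfolding e_def
    by (intro continuous_on_compose2[OF holomorphic_on_imp_continuous_on[OF h]] continuous_intros) auto
  then have "set_integrable lborel {0..1} (\<lambda>t. h (e t))"
    by (rule borel_integrable_atLeastAtMost')
  then have "(LINT t:{0..1}|lborel. h (e t)) = h 0"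
    using set_borel_integral_eq_integral(2) integral_unique[OF *] by metis
  then show ?thesis
    by (simp add: integral_restrict_space set_lebesgue_integral_def h_def e_def)
qed

text \<open>Rotation does not change the integral, so it may be averaged over all rotations. After
  the exchange of integrals the inner average over a circle is the constant
  \<open>g 0\<close>.\<close>

theorem fock_mean_value:
  assumes g: "g holomorphic_on UNIV" and int: "integrable fock_measure g"
  shows "(\<integral>z. g z \<partial>fock_measure) = g 0"
proof -
  define e where "e t = exp (2 * of_real pi * \<i> * of_real t)" for t :: real
  define M where "M = restrict_space (lborel :: real measure) {0..1}"
  have [measurable]: "g \<in> borel_measurable borel"
    using g by measurable
  have [measurable]: "e \<in> borel_measurable borel"
    unfolding e_def by measurable
  interpret M: prob_space M
    by standard (simp add: M_def emeasure_restrict_space space_restrict_space)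
  interpret P: pair_sigma_finite M fock_measure ..
  have [measurable]: "e \<in> borel_measurable M"
    unfolding M_def by (rule measurable_restrict_space1) measurable
  have e: "cmod (e t) = 1" for t
    by (simp add: e_def norm_exp_eq_Re)
  have rot: "(\<integral>z. h (e t * z) \<partial>fock_measure) = (\<integral>z. h z \<partial>fock_measure)"
    if "h \<in> borel_measurable borel" for h :: "complex \<Rightarrow> 'b :: {banach, second_countable_topology}" and t
    using integral_distr[of "(*) (e t)" fock_measure borel h] that by (simp add: distr_fock_rotate e)
  have rot_int: "integrable fock_measure (\<lambda>z. g (e t * z))" for t
    using integrable_distr[of "(*) (e t)" fock_measure borel g] int by (simp add: distr_fock_rotate e)
  \<comment> \<open>The inner integral of the norm is the same for every \<open>t\<close> by
    rotation invariance, hence integrable over the probability space \<open>M\<close>.\<close>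
  have "integrable (M \<Otimes>\<^sub>M fock_measure) (\<lambda>(t, z). g (e t * z))"
  proof (rule P.Fubini_integrable)
    show "integrable M (\<lambda>t. \<integral>z. norm (case (t, z) of (t, z) \<Rightarrow> g (e t * z)) \<partial>fock_measure)"
      using rot[of "\<lambda>z. norm (g z)"] by simp
    show "AE t in M. integrable fock_measure (\<lambda>z. case (t, z) of (t, z) \<Rightarrow> g (e t * z))"
      using rot_int by simp
  qed measurable
  then have "(\<integral>z. (\<integral>t. g (e t * z) \<partial>M) \<partial>fock_measure) = (\<integral>t. (\<integral>z. g (e t * z) \<partial>fock_measure) \<partial>M)"
    by (rule P.Fubini_integral)
  moreover have "(\<integral>t. g (e t * z) \<partial>M) = g 0" for z
    unfolding M_def e_def by (rule circle_mean_value[OF g])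
  ultimately show ?thesis
    using rot[of g] by (simp add: M.prob_space fock.prob_space[simplified])
qed

section \<open>The Fock space and its reproducing kernel\<close>

lemma borel_measurable_cnj [measurable (raw)]:
  assumes [measurable]: "f \<in> borel_measurable M"
  shows "(\<lambda>x. cnj (f x)) \<in> borel_measurable M"
  by (rule measurable_compose[OF assms borel_measurable_continuous_onI]) (intro continuous_intros)

lemma fock_spaceD:
  assumes "f \<in> fock_space"
  shows "f holomorphic_on UNIV" "integrable fock_measure (\<lambda>z. (cmod (f z))\<^sup>2)"
    "f \<in> borel_measurable borel"
  using assms borel_measurable_entire by (auto simp: fock_space_def)

text \<open>Squaring doubles the exponent, and \<open>2 * c < 1\<close> is what integrability
  against the Gaussian density requires.\<close>

lemma fock_spaceI_gaussian_bound:
  assumes f: "f holomorphic_on UNIV" and "c < 1 / 2" and "\<And>z. cmod (f z) \<le> K * exp (c * (cmod z)\<^sup>2)"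
  shows "f \<in> fock_space"
proof -
  have [measurable]: "f \<in> borel_measurable borel"
    using f by measurable
  have "integrable fock_measure (\<lambda>z. (cmod (f z))\<^sup>2)"
  proof (rule Bochner_Integration.integrable_bound)
    show "integrable fock_measure (\<lambda>z. K\<^sup>2 * exp (2 * c * (cmod z)\<^sup>2))"
      using assms by (intro integrable_mult_right integrable_fock_gaussian) auto
    show "AE z in fock_measure. norm ((cmod (f z))\<^sup>2) \<le> norm (K\<^sup>2 * exp (2 * c * (cmod z)\<^sup>2))"
      using power_mono[OF assms(3) norm_ge_zero, where n = 2]
      by (simp add: power_mult_distrib exp_double[symmetric] mult.assoc)
  qed measurable
  with f show ?thesis
    by (simp add: fock_space_def)
qed

text \<open>Stated for measurable functions, because one factor will be a conjugate or a real
  exponential weight and hence not holomorphic.\<close>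

lemma integrable_fock_mult:
  fixes f g :: "complex \<Rightarrow> complex"
  assumes [measurable]: "f \<in> borel_measurable borel" "g \<in> borel_measurable borel"
    and "integrable fock_measure (\<lambda>z. (cmod (f z))\<^sup>2)" "integrable fock_measure (\<lambda>z. (cmod (g z))\<^sup>2)"
  shows "integrable fock_measure (\<lambda>z. f z * g z)"
proof (rule Bochner_Integration.integrable_bound)
  show "integrable fock_measure (\<lambda>z. (cmod (f z))\<^sup>2 + (cmod (g z))\<^sup>2)"
    using assms by simp
  have "cmod (f z) * cmod (g z) \<le> (cmod (f z))\<^sup>2 + (cmod (g z))\<^sup>2" for z
    using sum_squares_bound[of "cmod (f z)" "cmod (g z)"]
      mult_nonneg_nonneg[OF norm_ge_zero[of "f z"] norm_ge_zero[of "g z"]]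
    by linarith
  then show "AE z in fock_measure. norm (f z * g z) \<le> norm ((cmod (f z))\<^sup>2 + (cmod (g z))\<^sup>2)"
    by (simp add: norm_mult)
qed measurable

lemma integrable_fock_inner:
  assumes "f \<in> fock_space" "g \<in> fock_space"
  shows "integrable fock_measure (\<lambda>z. f z * cnj (g z))"
  using assms by (intro integrable_fock_mult borel_measurable_cnj) (auto dest: fock_spaceD)

lemma fock_space_lincomb:
  assumes f: "f \<in> fock_space" and g: "g \<in> fock_space"
  shows "(\<lambda>z. a * f z + b * g z) \<in> fock_space"
proof -
  note [measurable] = fock_spaceD(3)[OF f] fock_spaceD(3)[OF g]
  have "integrable fock_measure (\<lambda>z. (cmod (a * f z + b * g z))\<^sup>2)"
  proof (rule Bochner_Integration.integrable_bound)
    show "integrable fock_measure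
        (\<lambda>z. 2 * (cmod a)\<^sup>2 * (cmod (f z))\<^sup>2 + 2 * (cmod b)\<^sup>2 * (cmod (g z))\<^sup>2)"
      using fock_spaceD(2)[OF f] fock_spaceD(2)[OF g] by simp
    have "(cmod (a * f z + b * g z))\<^sup>2 \<le> 2 * (cmod a)\<^sup>2 * (cmod (f z))\<^sup>2 + 2 * (cmod b)\<^sup>2 * (cmod (g z))\<^sup>2" for z
    proof -
      have "(cmod (a * f z + b * g z))\<^sup>2 \<le> (cmod (a * f z) + cmod (b * g z))\<^sup>2"
        by (intro power_mono norm_triangle_ineq) auto
      then show ?thesis
        using sum_squares_bound[of "cmod (a * f z)" "cmod (b * g z)"]
        by (simp add: power2_sum norm_mult power_mult_distrib)
    qed
    then show "AE z in fock_measure. norm ((cmod (a * f z + b * g z))\<^sup>2)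
        \<le> norm (2 * (cmod a)\<^sup>2 * (cmod (f z))\<^sup>2 + 2 * (cmod b)\<^sup>2 * (cmod (g z))\<^sup>2)"
      by simp
  qed measurable
  moreover have "(\<lambda>z. a * f z + b * g z) holomorphic_on UNIV"
    using fock_spaceD(1)[OF f] fock_spaceD(1)[OF g] by (intro holomorphic_intros)
  ultimately show ?thesis
    by (simp add: fock_space_def)
qed

lemma fock_space_diff:
  assumes "f \<in> fock_space" "g \<in> fock_space"
  shows "(\<lambda>z. f z - g z) \<in> fock_space"
  using fock_space_lincomb[OF assms, of 1 "-1"] by simp

lemma fock_space_cmult:
  assumes "f \<in> fock_space"
  shows "(\<lambda>z. a * f z) \<in> fock_space"
  using fock_space_lincomb[OF assms assms, of a 0] by simp

lemma fock_space_zero: "(\<lambda>_. 0) \<in> fock_space"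
  by (simp add: fock_space_def)

section \<open>Inner product, norm and Cauchy-Schwarz inequality\<close>

lemma fock_inner_commute: "fock_inner g f = cnj (fock_inner f g)"
  unfolding fock_inner_def by (subst Bochner_Integration.integral_cnj[symmetric]) (simp add: mult.commute)

lemma fock_inner_cmult_left: "fock_inner (\<lambda>z. a * f z) g = a * fock_inner f g"
  by (simp add: fock_inner_def mult.assoc)

lemma fock_inner_cmult_right: "fock_inner f (\<lambda>z. a * g z) = cnj a * fock_inner f g"
  by (simp add: fock_inner_def mult.left_commute)

lemma fock_inner_diff_left:
  assumes "f \<in> fock_space" "g \<in> fock_space" "h \<in> fock_space"
  shows "fock_inner (\<lambda>z. f z - g z) h = fock_inner f h - fock_inner g h"
  unfolding fock_inner_def using assms
  by (simp add: left_diff_distrib integrable_fock_inner)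

lemma fock_inner_diff_right:
  assumes "f \<in> fock_space" "g \<in> fock_space" "h \<in> fock_space"
  shows "fock_inner h (\<lambda>z. f z - g z) = fock_inner h f - fock_inner h g"
  unfolding fock_inner_def using assms
  by (simp add: right_diff_distrib integrable_fock_inner)

lemma fock_inner_self: "fock_inner f f = of_real (\<integral>z. (cmod (f z))\<^sup>2 \<partial>fock_measure)"
  unfolding fock_inner_def by (simp flip: complex_norm_square integral_complex_of_real)

lemma fock_norm_power2: "(fock_norm f)\<^sup>2 = (\<integral>z. (cmod (f z))\<^sup>2 \<partial>fock_measure)"
  by (simp add: fock_norm_def fock_inner_self)

lemma fock_norm_nonneg: "fock_norm f \<ge> 0"
  by (simp add: fock_norm_def fock_inner_self)

text \<open>The inequality for nonnegative extended integrals is applied to the moduli; square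
  integrability turns it into one between real numbers.\<close>

lemma fock_Cauchy_Schwarz:
  assumes f: "f \<in> fock_space" and g: "g \<in> fock_space"
  shows "cmod (fock_inner f g) \<le> fock_norm f * fock_norm g"
proof -
  note [measurable] = fock_spaceD(3)[OF f] fock_spaceD(3)[OF g]
  let ?I = "\<integral>z. cmod (f z) * cmod (g z) \<partial>fock_measure"
  have int: "integrable fock_measure (\<lambda>z. cmod (f z) * cmod (g z))"
    using integrable_norm[OF integrable_fock_inner[OF f g]] by (simp add: norm_mult)
  have "(\<integral>\<^sup>+z. ennreal (cmod (f z)) * ennreal (cmod (g z)) \<partial>fock_measure)\<^sup>2
      \<le> (\<integral>\<^sup>+z. (ennreal (cmod (f z)))\<^sup>2 \<partial>fock_measure) * (\<integral>\<^sup>+z. (ennreal (cmod (g z)))\<^sup>2 \<partial>fock_measure)"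
    by (rule Cauchy_Schwarz_nn_integral) measurable
  then have "ennreal (?I\<^sup>2) \<le> ennreal ((fock_norm f * fock_norm g)\<^sup>2)"
    using int fock_spaceD(2)[OF f] fock_spaceD(2)[OF g]
    by (simp add: ennreal_power nn_integral_eq_integral power_mult_distrib fock_norm_power2
        flip: ennreal_mult)
  then have "?I\<^sup>2 \<le> (fock_norm f * fock_norm g)\<^sup>2"
    by simp
  then have "?I \<le> fock_norm f * fock_norm g"
    by (rule power2_le_imp_le) (simp add: fock_norm_nonneg)
  moreover have "cmod (fock_inner f g) \<le> ?I"
    unfolding fock_inner_def using integral_norm_bound[of fock_measure "\<lambda>z. f z * cnj (g z)"]
    by (simp add: norm_mult)
  ultimately show ?thesis
    by simp
qed

lemma fock_inner_tendsto:
  assumes "\<And>n. F n \<in> fock_space" "f \<in> fock_space" "g \<in> fock_space"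
    and lim: "(\<lambda>n. fock_norm (\<lambda>z. F n z - f z)) \<longlonglongrightarrow> 0"
  shows "(\<lambda>n. fock_inner (F n) g) \<longlonglongrightarrow> fock_inner f g"
proof (rule LIM_zero_cancel, rule Lim_null_comparison)
  show "\<forall>\<^sub>F n in sequentially. norm (fock_inner (F n) g - fock_inner f g)
      \<le> fock_norm (\<lambda>z. F n z - f z) * fock_norm g"
    using assms fock_Cauchy_Schwarz[OF fock_space_diff]
    by (auto simp flip: fock_inner_diff_left)
  show "(\<lambda>n. fock_norm (\<lambda>z. F n z - f z) * fock_norm g) \<longlonglongrightarrow> 0"
    using tendsto_mult_left_zero[OF lim] .
qed

section \<open>Reproducing kernels and pointwise estimates\<close>

definition fock_kernel :: "complex \<Rightarrow> complex \<Rightarrow> complex" where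
  "fock_kernel w z = exp (cnj w * z)"

text \<open>Completing the square. This absorbs linear terms of an exponent into an arbitrarily
  small quadratic one.\<close>

lemma linear_le_quadratic:
  fixes x a e :: real
  assumes "e > 0"
  shows "a * x \<le> a\<^sup>2 / (4 * e) + e * x\<^sup>2"
proof -
  have "0 \<le> (a / (2 * e) - x)\<^sup>2 * e"
    using assms by simp
  also have "\<dots> = a\<^sup>2 / (4 * e) + e * x\<^sup>2 - a * x"
    using assms by (simp add: power2_eq_square field_simps)
  finally show ?thesis by simp
qed

lemma fock_kernel_in_fock_space: "fock_kernel w \<in> fock_space"
proof (rule fock_spaceI_gaussian_bound)
  show "fock_kernel w holomorphic_on UNIV"
    unfolding fock_kernel_def by (intro holomorphic_intros)
  \<comment> \<open>The value \<open>1 / 4\<close> is a choice below the threshold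
    \<open>1 / 2\<close>.\<close>
  show "cmod (fock_kernel w z) \<le> exp ((cmod w)\<^sup>2) * exp (1 / 4 * (cmod z)\<^sup>2)" for z
  proof -
    have "Re (cnj w * z) \<le> cmod w * cmod z"
      using complex_Re_le_cmod[of "cnj w * z"] by (simp add: norm_mult)
    also have "\<dots> \<le> (cmod w)\<^sup>2 + 1 / 4 * (cmod z)\<^sup>2"
      using linear_le_quadratic[of "1/4" "cmod w" "cmod z"] by simp
    finally show ?thesis
      by (simp add: fock_kernel_def norm_exp_eq_Re flip: exp_add)
  qed
qed auto

text \<open>Substituting \<open>z = w + u\<close> and completing the square, the density times the
  conjugate kernel becomes the density at \<open>u\<close> times \<open>exp (- cnj w * u)\<close>.
  The integral is thus that of the entire function \<open>g\<close>, and the mean value property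
  gives \<open>g 0 = f w\<close>.\<close>

theorem fock_reproducing:
  assumes f: "f \<in> fock_space"
  shows "fock_inner f (fock_kernel w) = f w"
proof -
  note [measurable] = fock_spaceD(3)[OF f]
  have K [measurable]: "fock_kernel w \<in> borel_measurable borel"
    by (rule fock_spaceD(3)[OF fock_kernel_in_fock_space])
  define g where "g u = f (w + u) * exp (- cnj w * u)" for u
  have g: "g holomorphic_on UNIV"
    unfolding g_def by (intro entire_compose[OF fock_spaceD(1)[OF f]] holomorphic_intros)
  then have [measurable]: "g \<in> borel_measurable borel"
    by measurable
  define h where "h z = (exp (- (cmod z)\<^sup>2) / pi) *\<^sub>R (f z * cnj (fock_kernel w z))" for z
  have [measurable]: "h \<in> borel_measurable borel"
    unfolding h_def by measurable
  have "exp (of_real (- (cmod (w + u))\<^sup>2)) * exp (w * cnj (w + u))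
      = exp (of_real (- (cmod u)\<^sup>2)) * exp (- cnj w * u)" for u
    unfolding mult_exp_exp
    by (rule arg_cong[where f = exp]) (simp only: of_real_minus complex_norm_square, simp add: algebra_simps)
  then have "complex_of_real (exp (- (cmod (w + u))\<^sup>2)) * exp (w * cnj (w + u))
      = complex_of_real (exp (- (cmod u)\<^sup>2)) * exp (- cnj w * u)" for u
    by (simp only: exp_of_real)
  then have shift: "h (w + u) = (exp (- (cmod u)\<^sup>2) / pi) *\<^sub>R g u" for u
    by (simp add: h_def g_def fock_kernel_def scaleR_conv_of_real exp_cnj mult.left_commute)
  have distr: "distr lborel borel ((+) w) = lborel"
    by (rule lborel_distr_plus)
  have "integrable lborel h"
    using integrable_fock_inner[OF f fock_kernel_in_fock_space[of w]]
    unfolding h_def by (subst (asm) integrable_fock_iff) measurable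
  then have "integrable lborel (\<lambda>u. h (w + u))"
    using integrable_distr[of "(+) w" lborel borel h] by (simp add: distr)
  then have "integrable fock_measure g"
    by (simp add: integrable_fock_iff shift)
  have "fock_inner f (fock_kernel w) = (\<integral>z. h z \<partial>lborel)"
    unfolding fock_inner_def h_def by (rule integral_fock) measurable
  also have "\<dots> = (\<integral>u. h (w + u) \<partial>lborel)"
    using integral_distr[of "(+) w" lborel borel h] by (simp add: distr)
  also have "\<dots> = (\<integral>u. g u \<partial>fock_measure)"
    by (simp add: integral_fock shift)
  also have "\<dots> = f w"
    using fock_mean_value[OF g \<open>integrable fock_measure g\<close>] by (simp add: g_def)
  finally show ?thesis .
qed

text \<open>The reproducing property applied to the kernel itself gives its squared norm as the
  value of \<open>fock_kernel w\<close> at \<open>w\<close>.\<close>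

lemma fock_norm_kernel: "fock_norm (fock_kernel w) = exp ((cmod w)\<^sup>2 / 2)"
proof -
  have "fock_inner (fock_kernel w) (fock_kernel w) = exp (of_real ((cmod w)\<^sup>2))"
    unfolding fock_reproducing[OF fock_kernel_in_fock_space]
    by (simp only: fock_kernel_def complex_norm_square mult.commute)
  then have "(fock_norm (fock_kernel w))\<^sup>2 = (exp ((cmod w)\<^sup>2 / 2))\<^sup>2"
    by (simp add: fock_norm_def exp_of_real flip: exp_double of_real_power)
  then show ?thesis
    by (rule power2_eq_imp_eq) (simp_all add: fock_norm_nonneg)
qed

text \<open>Cauchy-Schwarz against the kernel at \<open>z\<close>.\<close>

lemma fock_growth:
  assumes "f \<in> fock_space"
  shows "cmod (f z) \<le> fock_norm f * exp ((cmod z)\<^sup>2 / 2)"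
  using fock_Cauchy_Schwarz[OF assms fock_kernel_in_fock_space, of z]
  by (simp add: fock_reproducing[OF assms] fock_norm_kernel)

lemma fock_tendsto_imp_pointwise:
  assumes F: "\<And>n. F n \<in> fock_space" and f: "f \<in> fock_space"
    and lim: "(\<lambda>n. fock_norm (\<lambda>z. F n z - f z)) \<longlonglongrightarrow> 0"
  shows "(\<lambda>n. F n z) \<longlonglongrightarrow> f z"
  using fock_inner_tendsto[OF F f fock_kernel_in_fock_space lim, of z]
  by (simp add: fock_reproducing F f)

section \<open>Weighted composition with a strictly contractive affine map\<close>

text \<open>Provides the majorants for the exchange of integrals below. The weight is itself square
  integrable, since the quadratic part of its doubled exponent has coefficient
  \<open>\<bar>a\<bar> < 1\<close>.\<close>

lemma integrable_fock_weight:
  fixes a s :: real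
  assumes f: "f \<in> fock_space" and a: "\<bar>a\<bar> < 1"
  shows "integrable fock_measure (\<lambda>z. cmod (f z) * exp (s * cmod z + \<bar>a\<bar> * (cmod z)\<^sup>2 / 2))"
proof -
  define w where "w z = complex_of_real (exp (s * cmod z + \<bar>a\<bar> * (cmod z)\<^sup>2 / 2))" for z
  note [measurable] = fock_spaceD(3)[OF f]
  have [measurable]: "w \<in> borel_measurable borel"
    unfolding w_def by measurable
  \<comment> \<open>Half of the gap between \<open>\<bar>a\<bar>\<close> and \<open>1\<close>: the
    linear term is absorbed at cost \<open>e\<close>, and \<open>\<bar>a\<bar> + e\<close> stays
    below \<open>1\<close>.\<close>
  define e where "e = (1 - \<bar>a\<bar>) / 2"
  have e: "e > 0"
    using a by (simp add: e_def)
  have "integrable fock_measure (\<lambda>z. (cmod (w z))\<^sup>2)"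
  proof (rule Bochner_Integration.integrable_bound)
    show "integrable fock_measure (\<lambda>z. exp ((2 * s)\<^sup>2 / (4 * e)) * exp ((\<bar>a\<bar> + e) * (cmod z)\<^sup>2))"
      using a by (intro integrable_mult_right integrable_fock_gaussian) (simp add: e_def field_simps)
    have "2 * (s * cmod z + \<bar>a\<bar> * (cmod z)\<^sup>2 / 2) \<le> (2 * s)\<^sup>2 / (4 * e) + (\<bar>a\<bar> + e) * (cmod z)\<^sup>2" for z
      using linear_le_quadratic[OF e, of "2 * s" "cmod z"] by (simp add: algebra_simps)
    then show "AE z in fock_measure. norm ((cmod (w z))\<^sup>2)
        \<le> norm (exp ((2 * s)\<^sup>2 / (4 * e)) * exp ((\<bar>a\<bar> + e) * (cmod z)\<^sup>2))"
      by (simp add: w_def flip: exp_double exp_add)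
  qed measurable
  then have "integrable fock_measure (\<lambda>z. f z * w z)"
    by (intro integrable_fock_mult fock_spaceD[OF f]) measurable
  from integrable_norm[OF this] show ?thesis
    by (simp add: norm_mult w_def)
qed

text \<open>For \<open>\<bar>a\<bar> < 1\<close> one may insert the reproducing formula for \<open>f\<close> and exchange the integrals.\<close>

theorem fock_weighted_comp_adjoint:
  fixes a :: real
  assumes f: "f \<in> fock_space" and g: "g \<in> fock_space" and a: "\<bar>a\<bar> < 1"
  shows "fock_inner (\<lambda>z. exp (cnj \<beta> * z) * f (of_real a * z + b)) g
       = fock_inner f (\<lambda>z. exp (cnj b * z) * g (of_real a * z + \<beta>))"
proof -
  note [measurable] = fock_spaceD(3)[OF f] fock_spaceD(3)[OF g]
  \<comment> \<open>The integrand of the double integral obtained by writing \<open>f\<close> at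
    \<open>of_real a * z + b\<close> as an inner product with the kernel there.\<close>
  define H where "H z w = exp (cnj \<beta> * z) * exp ((of_real a * z + b) * cnj w) * f w * cnj (g z)" for z w
  define u where "u z = cmod (g z) * exp (cmod \<beta> * cmod z + \<bar>a\<bar> * (cmod z)\<^sup>2 / 2)" for z
  define v where "v w = cmod (f w) * exp (cmod b * cmod w + \<bar>a\<bar> * (cmod w)\<^sup>2 / 2)" for w
  have u: "integrable fock_measure u" and v: "integrable fock_measure v"
    unfolding u_def v_def using f g a by (intro integrable_fock_weight; simp)+
  have [measurable]: "u \<in> borel_measurable borel" "v \<in> borel_measurable borel"
    unfolding u_def v_def by measurable
  have uv: "integrable (fock_measure \<Otimes>\<^sub>M fock_measure) (\<lambda>(z, w). u z * v w)"
  proof (rule fock_pair.Fubini_integrable)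
    show "integrable fock_measure (\<lambda>z. \<integral>w. norm (case (z, w) of (z, w) \<Rightarrow> u z * v w) \<partial>fock_measure)"
      using u by (simp add: abs_mult)
    show "AE z in fock_measure. integrable fock_measure (\<lambda>w. case (z, w) of (z, w) \<Rightarrow> u z * v w)"
      using v by simp
  qed measurable
  have bound: "cmod (H z w) \<le> u z * v w" for z w
  proof -
    have 1: "Re (cnj \<beta> * z) \<le> cmod \<beta> * cmod z"
      using complex_Re_le_cmod[of "cnj \<beta> * z"] by (simp add: norm_mult)
    have 2: "Re (b * cnj w) \<le> cmod b * cmod w"
      using complex_Re_le_cmod[of "b * cnj w"] by (simp add: norm_mult)
    have "Re (of_real a * z * cnj w) \<le> \<bar>a\<bar> * (cmod z * cmod w)"
      using complex_Re_le_cmod[of "of_real a * z * cnj w"] by (simp add: norm_mult)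
    \<comment> \<open>The mixed term is split into separate squares, so the majorant is a product of
      a function of \<open>z\<close> and one of \<open>w\<close>.\<close>
    also have "\<dots> \<le> \<bar>a\<bar> * (((cmod z)\<^sup>2 + (cmod w)\<^sup>2) / 2)"
      using sum_squares_bound[of "cmod z" "cmod w"] by (intro mult_left_mono) auto
    finally have 3: "Re (of_real a * z * cnj w) \<le> \<bar>a\<bar> * (cmod z)\<^sup>2 / 2 + \<bar>a\<bar> * (cmod w)\<^sup>2 / 2"
      by (simp add: algebra_simps)
    have "Re (cnj \<beta> * z) + Re ((of_real a * z + b) * cnj w)
        \<le> (cmod \<beta> * cmod z + \<bar>a\<bar> * (cmod z)\<^sup>2 / 2) + (cmod b * cmod w + \<bar>a\<bar> * (cmod w)\<^sup>2 / 2)"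
      using 1 2 3 by (simp only: distrib_right plus_complex.simps)
    then have "exp (Re (cnj \<beta> * z)) * exp (Re ((of_real a * z + b) * cnj w))
        \<le> exp (cmod \<beta> * cmod z + \<bar>a\<bar> * (cmod z)\<^sup>2 / 2) * exp (cmod b * cmod w + \<bar>a\<bar> * (cmod w)\<^sup>2 / 2)"
      by (simp only: mult_exp_exp exp_le_cancel_iff)
    then have "(exp (Re (cnj \<beta> * z)) * exp (Re ((of_real a * z + b) * cnj w))) * (cmod (f w) * cmod (g z))
        \<le> (exp (cmod \<beta> * cmod z + \<bar>a\<bar> * (cmod z)\<^sup>2 / 2) * exp (cmod b * cmod w + \<bar>a\<bar> * (cmod w)\<^sup>2 / 2))
            * (cmod (f w) * cmod (g z))"
      by (rule mult_right_mono) simp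
    then show ?thesis
      unfolding H_def u_def v_def norm_mult norm_exp_eq_Re complex_mod_cnj by (simp only: mult_ac)
  qed
  have H: "integrable (fock_measure \<Otimes>\<^sub>M fock_measure) (case_prod H)"
  proof (rule Bochner_Integration.integrable_bound[OF uv])
    show "case_prod H \<in> borel_measurable (fock_measure \<Otimes>\<^sub>M fock_measure)"
      unfolding H_def by measurable
    show "AE p in fock_measure \<Otimes>\<^sub>M fock_measure. norm (case_prod H p) \<le> norm (case p of (z, w) \<Rightarrow> u z * v w)"
      using bound by (auto simp: split_beta abs_mult u_def v_def)
  qed
  have "(\<integral>w. H z w \<partial>fock_measure) = exp (cnj \<beta> * z) * f (of_real a * z + b) * cnj (g z)" for z
  proof -
    have "(\<integral>w. H z w \<partial>fock_measure)
        = (\<integral>w. (exp (cnj \<beta> * z) * cnj (g z)) * (f w * cnj (fock_kernel (of_real a * z + b) w)) \<partial>fock_measure)"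
      by (intro Bochner_Integration.integral_cong) (auto simp: H_def fock_kernel_def exp_cnj)
    also have "\<dots> = (exp (cnj \<beta> * z) * cnj (g z)) * fock_inner f (fock_kernel (of_real a * z + b))"
      unfolding fock_inner_def by (rule integral_mult_right_zero)
    finally show ?thesis
      by (simp add: fock_reproducing[OF f])
  qed
  \<comment> \<open>Integrating over \<open>z\<close> first, it is \<open>g\<close> that gets
    reproduced, in conjugated form.\<close>
  moreover have "(\<integral>z. H z w \<partial>fock_measure) = f w * cnj (exp (cnj b * w) * g (of_real a * w + \<beta>))" for w
  proof -
    have "(\<integral>z. H z w \<partial>fock_measure)
        = (\<integral>z. (exp (b * cnj w) * f w) * cnj (g z * cnj (fock_kernel (of_real a * w + \<beta>) z)) \<partial>fock_measure)"
      by (intro Bochner_Integration.integral_cong)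
         (auto simp: H_def fock_kernel_def exp_cnj distrib_left distrib_right exp_add mult_ac)
    also have "\<dots> = (exp (b * cnj w) * f w) * cnj (fock_inner g (fock_kernel (of_real a * w + \<beta>)))"
      unfolding fock_inner_def by (simp only: integral_mult_right_zero Bochner_Integration.integral_cnj)
    finally show ?thesis
      by (simp add: fock_reproducing[OF g] exp_cnj)
  qed
  ultimately show ?thesis
    using fock_pair.Fubini_integral[OF H] by (simp add: fock_inner_def)
qed

section \<open>Dilations and density of polynomials\<close>

text \<open>Dominated convergence with moving majorants whose integrals converge. The ordinary
  theorem applies to \<open>D n\<close>, the positive part of \<open>G' - (G n - h n)\<close>, which
  lies below \<open>G'\<close>. Since \<open>h n \<le> D n + (G n - G')\<close>, the integrals of
  \<open>h n\<close> are squeezed to zero.\<close>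

lemma dominated_convergence_varying:
  fixes G :: "nat \<Rightarrow> 'a \<Rightarrow> real"
  assumes G: "\<And>n. integrable M (G n)" and G': "integrable M G'"
    and lim: "\<And>x. (\<lambda>n. G n x) \<longlonglongrightarrow> G' x"
    and lim_int: "(\<lambda>n. \<integral>x. G n x \<partial>M) \<longlonglongrightarrow> (\<integral>x. G' x \<partial>M)"
    and [measurable]: "\<And>n. h n \<in> borel_measurable M"
    and h: "\<And>n x. 0 \<le> h n x" "\<And>n x. h n x \<le> G n x"
    and h_lim: "\<And>x. (\<lambda>n. h n x) \<longlonglongrightarrow> 0"
  shows "(\<lambda>n. \<integral>x. h n x \<partial>M) \<longlonglongrightarrow> 0"
proof -
  note [measurable] = borel_measurable_integrable[OF G] borel_measurable_integrable[OF G']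
  have G'_nonneg: "0 \<le> G' x" for x
    using order_trans[OF h] by (intro LIMSEQ_le_const[OF lim]) blast
  have "\<bar>h n x\<bar> \<le> \<bar>G n x\<bar>" for n x
    using h[of n x] by linarith
  then have h_int: "integrable M (h n)" for n
    by (intro Bochner_Integration.integrable_bound[OF G[of n]] AE_I2) simp_all
  define D where "D n x = max 0 (G' x - (G n x - h n x))" for n x
  have [measurable]: "D n \<in> borel_measurable M" for n
    unfolding D_def[abs_def] by measurable
  have D_bound: "\<bar>D n x\<bar> \<le> G' x" for n x
    using h(2)[of n x] G'_nonneg[of x] by (auto simp: D_def)
  have D_int: "integrable M (D n)" for n
    using D_bound[of n] order_trans[OF D_bound abs_ge_self]
    by (intro Bochner_Integration.integrable_bound[OF G'] AE_I2) simp_all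
  have "(\<lambda>n. \<integral>x. D n x \<partial>M) \<longlonglongrightarrow> (\<integral>x. 0 \<partial>M)"
  proof (rule integral_dominated_convergence[OF _ _ G'])
    have "(\<lambda>n. D n x) \<longlonglongrightarrow> max 0 (G' x - (G' x - 0))" for x
      unfolding D_def by (intro tendsto_intros lim h_lim)
    then show "AE x in M. (\<lambda>n. D n x) \<longlonglongrightarrow> 0" by simp
  qed (simp_all add: D_bound)
  then have upper: "(\<lambda>n. (\<integral>x. D n x \<partial>M) + ((\<integral>x. G n x \<partial>M) - (\<integral>x. G' x \<partial>M))) \<longlonglongrightarrow> 0"
    using tendsto_add[OF _ tendsto_diff[OF lim_int tendsto_const[of "\<integral>x. G' x \<partial>M"]]] by fastforce
  have "(\<integral>x. h n x \<partial>M) \<le> (\<integral>x. D n x \<partial>M) + ((\<integral>x. G n x \<partial>M) - (\<integral>x. G' x \<partial>M))" for n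
  proof -
    have "(\<integral>x. h n x \<partial>M) \<le> (\<integral>x. D n x + (G n x - G' x) \<partial>M)"
      using h_int D_int G G' by (intro integral_mono) (auto simp: D_def)
    then show ?thesis
      using D_int G G' by simp
  qed
  moreover have "0 \<le> (\<integral>x. h n x \<partial>M)" for n
    by (rule Bochner_Integration.integral_nonneg) (rule h(1))
  ultimately show ?thesis
    by (intro tendsto_sandwich[OF always_eventually always_eventually tendsto_const upper] allI)
qed

lemma lborel_affine_integral:
  fixes G :: "'a :: euclidean_space \<Rightarrow> real"
  assumes "integrable lborel G" and c: "c \<noteq> 0"
  shows "integrable lborel (\<lambda>x. G (t + c *\<^sub>R x))"
    and "(\<integral>x. G (t + c *\<^sub>R x) \<partial>lborel) = (\<integral>x. G x \<partial>lborel) / \<bar>c\<bar> ^ DIM('a)"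
proof -
  have [measurable]: "G \<in> borel_measurable borel"
    using borel_measurable_integrable[OF assms(1)] by simp
  define D where "D = distr lborel borel (\<lambda>x::'a. t + c *\<^sub>R x)"
  have eq: "lborel = density D (\<lambda>_. ennreal (\<bar>c\<bar> ^ DIM('a)))"
    using lborel_affine[OF c, of t] by (simp add: D_def ennreal_power)
  have [measurable]: "G \<in> borel_measurable D"
    by (simp add: D_def)
  have "integrable D (\<lambda>x. (\<bar>c\<bar> ^ DIM('a)) *\<^sub>R G x)"
    using assms(1) by (subst (asm) eq, subst (asm) integrable_density) auto
  then have "integrable D G"
    using c by simp
  then show "integrable lborel (\<lambda>x. G (t + c *\<^sub>R x))"
    unfolding D_def by (subst (asm) integrable_distr_eq) auto
  have "(\<integral>x. G x \<partial>lborel) = (\<integral>x. (\<bar>c\<bar> ^ DIM('a)) *\<^sub>R G x \<partial>D)"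
    by (subst eq, subst integral_density) auto
  also have "\<dots> = \<bar>c\<bar> ^ DIM('a) * (\<integral>x. G x \<partial>D)"
    by simp
  also have "(\<integral>x. G x \<partial>D) = (\<integral>x. G (t + c *\<^sub>R x) \<partial>lborel)"
    unfolding D_def by (subst integral_distr) auto
  finally show "(\<integral>x. G (t + c *\<^sub>R x) \<partial>lborel) = (\<integral>x. G x \<partial>lborel) / \<bar>c\<bar> ^ DIM('a)"
    using c by simp
qed

text \<open>The bound \<open>M\<close> makes the left-hand side dominated by the affine translates of a single integrable
  function, whose integrals converge although the functions themselves have no common majorant.\<close>

lemma fock_weighted_comp_tendsto:
  fixes r :: "nat \<Rightarrow> real"
  assumes F: "F \<in> fock_space"
    and \<psi>: "\<And>n. \<psi> n holomorphic_on UNIV"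
    and bound: "\<And>n z. cmod (\<psi> n z) ^ 2 * exp ((cmod (of_real (r n) * z + c n))\<^sup>2) \<le> M * exp ((cmod z)\<^sup>2)"
    and r: "\<And>n. r n \<noteq> 0" "r \<longlonglongrightarrow> 1" and c: "c \<longlonglongrightarrow> 0"
    and \<psi>_lim: "\<And>z. (\<lambda>n. \<psi> n z) \<longlonglongrightarrow> 1"
  shows "\<And>n. (\<lambda>z. \<psi> n z * F (of_real (r n) * z + c n)) \<in> fock_space"
    and "(\<lambda>n. fock_norm (\<lambda>z. \<psi> n z * F (of_real (r n) * z + c n) - F z)) \<longlonglongrightarrow> 0"
proof -
  define \<rho> where "\<rho> z = exp (- (cmod z)\<^sup>2) / pi" for z
  define G where "G z = \<rho> z * (cmod (F z))\<^sup>2" for z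
  define V where "V n z = \<psi> n z * F (of_real (r n) * z + c n)" for n z
  have V: "V n holomorphic_on UNIV" for n
    unfolding V_def
    by (intro holomorphic_on_mult \<psi> entire_compose[OF fock_spaceD(1)[OF F]] holomorphic_intros)
  note [measurable] = fock_spaceD(3)[OF F] borel_measurable_entire[OF V]
  have \<rho>: "\<rho> z \<ge> 0" for z
    by (simp add: \<rho>_def)
  have [measurable]: "\<rho> \<in> borel_measurable borel"
    unfolding \<rho>_def by measurable
  have G: "integrable lborel G"
    using fock_spaceD(2)[OF F] by (subst (asm) integrable_fock_iff) (auto simp: G_def[abs_def] \<rho>_def)
  define Gn where "Gn n z = G (of_real (r n) * z + c n)" for n z
  have Gn: "integrable lborel (Gn n)" "(\<integral>z. Gn n z \<partial>lborel) = (\<integral>z. G z \<partial>lborel) / (r n)\<^sup>2" for n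
    using lborel_affine_integral[OF G r(1)[of n], of "c n"]
    by (simp_all add: Gn_def[abs_def] scaleR_conv_of_real add.commute)
  have V_bound: "\<rho> z * (cmod (V n z))\<^sup>2 \<le> M * Gn n z" for n z
  proof -
    let ?y = "of_real (r n) * z + c n"
    \<comment> \<open>This factor trades the Gaussian weight at \<open>z\<close> for the one at the
      image point, so that \<open>Gn n\<close> appears.\<close>
    have "(cmod (\<psi> n z))\<^sup>2 * exp ((cmod ?y)\<^sup>2) * (\<rho> z * (cmod (F ?y))\<^sup>2 * exp (- (cmod ?y)\<^sup>2))
        \<le> M * exp ((cmod z)\<^sup>2) * (\<rho> z * (cmod (F ?y))\<^sup>2 * exp (- (cmod ?y)\<^sup>2))"
      by (intro mult_right_mono bound) (simp add: \<rho>)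
    then have "(cmod (\<psi> n z))\<^sup>2 * (exp ((cmod ?y)\<^sup>2) * exp (- (cmod ?y)\<^sup>2)) * (\<rho> z * (cmod (F ?y))\<^sup>2)
        \<le> M * (exp ((cmod z)\<^sup>2) * exp (- (cmod z)\<^sup>2)) * ((cmod (F ?y))\<^sup>2 * exp (- (cmod ?y)\<^sup>2) / pi)"
      by (simp add: \<rho>_def mult_ac)
    then show ?thesis
      unfolding mult_exp_exp
      by (simp add: V_def Gn_def G_def \<rho>_def norm_mult power_mult_distrib mult_ac)
  qed
  show V_fock: "V n \<in> fock_space" for n
  proof -
    have "integrable lborel (\<lambda>z. \<rho> z * (cmod (V n z))\<^sup>2)"
    proof (rule Bochner_Integration.integrable_bound)
      show "integrable lborel (\<lambda>z. M * Gn n z)"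
        using Gn(1) by simp
      show "AE z in lborel. norm (\<rho> z * (cmod (V n z))\<^sup>2) \<le> norm (M * Gn n z)"
        using order_trans[OF V_bound[of _ n] abs_ge_self] \<rho> by (intro AE_I2) simp
    qed measurable
    then have "integrable fock_measure (\<lambda>z. (cmod (V n z))\<^sup>2)"
      by (subst integrable_fock_iff) (auto simp: \<rho>_def)
    with V show ?thesis
      by (simp add: fock_space_def)
  qed
  have arg_lim: "(\<lambda>n. of_real (r n) * z + c n) \<longlonglongrightarrow> z" for z
    using tendsto_add[OF tendsto_mult[OF tendsto_of_real[OF r(2)] tendsto_const[of z]] c] by simp
  have cont: "continuous_on UNIV F"
    by (rule holomorphic_on_imp_continuous_on[OF fock_spaceD(1)[OF F]])
  have F_lim: "(\<lambda>n. F (of_real (r n) * z + c n)) \<longlonglongrightarrow> F z" for z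
    using continuous_on_tendsto_compose[OF cont arg_lim] by simp
  have G_lim: "(\<lambda>n. Gn n z) \<longlonglongrightarrow> G z" for z
    using F_lim[of z] arg_lim[of z]
    unfolding Gn_def G_def \<rho>_def
    by (intro tendsto_intros) auto
  have "(\<lambda>n. (\<integral>z. G z \<partial>lborel) / (r n)\<^sup>2) \<longlonglongrightarrow> (\<integral>z. G z \<partial>lborel) / 1\<^sup>2"
    by (intro tendsto_intros r) simp
  then have int_lim: "(\<lambda>n. \<integral>z. Gn n z \<partial>lborel) \<longlonglongrightarrow> (\<integral>z. G z \<partial>lborel)"
    by (simp add: Gn)
  have "(\<lambda>n. \<integral>z. \<rho> z * (cmod (V n z - F z))\<^sup>2 \<partial>lborel) \<longlonglongrightarrow> 0"
  proof (rule dominated_convergence_varying)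
    \<comment> \<open>The majorant stems from bounding the squared modulus of a difference by twice
      the sum of the squares.\<close>
    show "integrable lborel (\<lambda>z. 2 * M * Gn n z + 2 * G z)" for n
      using Gn(1) G by simp
    show "integrable lborel (\<lambda>z. 2 * M * G z + 2 * G z)"
      using G by simp
    show "(\<lambda>n. 2 * M * Gn n z + 2 * G z) \<longlonglongrightarrow> 2 * M * G z + 2 * G z" for z
      by (intro tendsto_intros G_lim)
    have "(\<lambda>n. 2 * M * (\<integral>z. Gn n z \<partial>lborel) + 2 * (\<integral>z. G z \<partial>lborel))
        \<longlonglongrightarrow> 2 * M * (\<integral>z. G z \<partial>lborel) + 2 * (\<integral>z. G z \<partial>lborel)"
      by (intro tendsto_intros int_lim)
    then show "(\<lambda>n. \<integral>z. 2 * M * Gn n z + 2 * G z \<partial>lborel) \<longlonglongrightarrow> (\<integral>z. 2 * M * G z + 2 * G z \<partial>lborel)"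
      using Gn(1) G by simp
    show "0 \<le> \<rho> z * (cmod (V n z - F z))\<^sup>2" for n z
      using \<rho> by simp
    show "\<rho> z * (cmod (V n z - F z))\<^sup>2 \<le> 2 * M * Gn n z + 2 * G z" for n z
    proof -
      have "(cmod (V n z - F z))\<^sup>2 \<le> (cmod (V n z) + cmod (F z))\<^sup>2"
        by (intro power_mono norm_triangle_ineq4) auto
      also have "\<dots> \<le> 2 * (cmod (V n z))\<^sup>2 + 2 * (cmod (F z))\<^sup>2"
        using sum_squares_bound[of "cmod (V n z)" "cmod (F z)"] by (simp add: power2_sum)
      finally have "\<rho> z * (cmod (V n z - F z))\<^sup>2 \<le> \<rho> z * (2 * (cmod (V n z))\<^sup>2 + 2 * (cmod (F z))\<^sup>2)"
        by (rule mult_left_mono[OF _ \<rho>])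
      then show ?thesis
        using V_bound[of z n] by (simp add: G_def algebra_simps)
    qed
    have "(\<lambda>n. \<rho> z * (cmod (V n z - F z))\<^sup>2) \<longlonglongrightarrow> \<rho> z * (cmod (1 * F z - F z))\<^sup>2" for z
      unfolding V_def by (intro tendsto_intros \<psi>_lim F_lim)
    then show "(\<lambda>n. \<rho> z * (cmod (V n z - F z))\<^sup>2) \<longlonglongrightarrow> 0" for z
      by simp
  qed measurable
  moreover have "(\<integral>z. \<rho> z * (cmod (V n z - F z))\<^sup>2 \<partial>lborel) = (fock_norm (\<lambda>z. V n z - F z))\<^sup>2" for n
    unfolding fock_norm_power2 by (subst integral_fock) (auto simp: \<rho>_def)
  ultimately have "(\<lambda>n. sqrt ((fock_norm (\<lambda>z. V n z - F z))\<^sup>2)) \<longlonglongrightarrow> sqrt 0"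
    by (intro tendsto_real_sqrt) simp
  then show "(\<lambda>n. fock_norm (\<lambda>z. V n z - F z)) \<longlonglongrightarrow> 0"
    by (simp add: fock_norm_nonneg)
qed

text \<open>The case of constant weight \<open>1\<close>, shift \<open>0\<close> and
  \<open>M = 1\<close>; the bound holds because the dilation shrinks moduli.\<close>

lemma fock_dilation_tendsto:
  fixes r :: "nat \<Rightarrow> real"
  assumes f: "f \<in> fock_space" and r: "\<And>n. 0 < r n" "\<And>n. r n < 1" "r \<longlonglongrightarrow> 1"
  shows "\<And>n. (\<lambda>z. f (of_real (r n) * z)) \<in> fock_space"
    and "(\<lambda>n. fock_norm (\<lambda>z. f (of_real (r n) * z) - f z)) \<longlonglongrightarrow> 0"
proof -
  have *: "cmod 1 ^ 2 * exp ((cmod (of_real (r n) * z + 0))\<^sup>2) \<le> 1 * exp ((cmod z)\<^sup>2)" for n z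
  proof -
    have "(r n * cmod z)\<^sup>2 \<le> (1 * cmod z)\<^sup>2"
      using r(1)[of n] r(2)[of n] by (intro power_mono mult_right_mono) auto
    then show ?thesis
      using r(1)[of n] by (simp add: norm_mult)
  qed
  have nz: "r n \<noteq> 0" for n
    using r(1)[of n] by simp
  show "(\<lambda>z. f (of_real (r n) * z)) \<in> fock_space" for n
    using fock_weighted_comp_tendsto(1)[of f "\<lambda>_ _. 1" r "\<lambda>_. 0" 1, OF f _ * nz r(3)] by simp
  show "(\<lambda>n. fock_norm (\<lambda>z. f (of_real (r n) * z) - f z)) \<longlonglongrightarrow> 0"
    using fock_weighted_comp_tendsto(2)[of f "\<lambda>_ _. 1" r "\<lambda>_. 0" 1, OF f _ * nz r(3)] by simp
qed

section \<open>Subgaussian functions, a supply of elements of the domain\<close>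

text \<open>Quantifying over all \<open>e\<close> makes the class stable under products and affine
  substitutions. It contains the polynomials and the kernels, and the affine weighted compositions
  used here preserve it.\<close>

definition subgaussian :: "(complex \<Rightarrow> complex) \<Rightarrow> bool" where
  "subgaussian f \<longleftrightarrow> (\<forall>e>0. \<exists>K. \<forall>z. cmod (f z) \<le> K * exp (e * (cmod z)\<^sup>2))"

lemma subgaussianI:
  assumes "\<And>e. e > 0 \<Longrightarrow> \<exists>K. \<forall>z. cmod (f z) \<le> K * exp (e * (cmod z)\<^sup>2)"
  shows "subgaussian f"
  using assms by (simp add: subgaussian_def)

lemma subgaussianE:
  assumes "subgaussian f" "e > 0"
  obtains K where "K \<ge> 0" "\<And>z. cmod (f z) \<le> K * exp (e * (cmod z)\<^sup>2)"
proof -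
  obtain K where K: "\<And>z. cmod (f z) \<le> K * exp (e * (cmod z)\<^sup>2)"
    using assms by (auto simp: subgaussian_def)
  have "K \<ge> 0"
    using order_trans[OF norm_ge_zero K[of 0]] by simp
  with K that show ?thesis by blast
qed

lemma subgaussian_exp_linear: "subgaussian (\<lambda>z. exp (b * z))"
proof (rule subgaussianI)
  fix e :: real assume e: "e > 0"
  have "cmod (exp (b * z)) \<le> exp ((cmod b)\<^sup>2 / (4 * e)) * exp (e * (cmod z)\<^sup>2)" for z
  proof -
    have "Re (b * z) \<le> cmod b * cmod z"
      using complex_Re_le_cmod[of "b * z"] by (simp add: norm_mult)
    also note linear_le_quadratic[OF e]
    finally show ?thesis
      by (simp only: norm_exp_eq_Re mult_exp_exp exp_le_cancel_iff)
  qed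
  then show "\<exists>K. \<forall>z. cmod (exp (b * z)) \<le> K * exp (e * (cmod z)\<^sup>2)" by blast
qed

lemma subgaussian_const: "subgaussian (\<lambda>_. a)"
proof (rule subgaussianI)
  fix e :: real assume "e > 0"
  then have "cmod a * 1 \<le> cmod a * exp (e * (cmod z)\<^sup>2)" for z
    by (intro mult_left_mono) auto
  then show "\<exists>K. \<forall>z::complex. cmod a \<le> K * exp (e * (cmod z)\<^sup>2)" by auto
qed

lemma subgaussian_id: "subgaussian (\<lambda>z. z)"
proof (rule subgaussianI)
  fix e :: real assume e: "e > 0"
  have "cmod z \<le> exp (1 / (4 * e)) * exp (e * (cmod z)\<^sup>2)" for z
  proof -
    have "cmod z \<le> exp (cmod z)"
      using exp_ge_add_one_self[of "cmod z"] by linarith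
    also have "\<dots> \<le> exp (1 / (4 * e)) * exp (e * (cmod z)\<^sup>2)"
      using linear_le_quadratic[OF e, of 1 "cmod z"] by (simp add: mult_exp_exp)
    finally show ?thesis .
  qed
  then show "\<exists>K. \<forall>z. cmod z \<le> K * exp (e * (cmod z)\<^sup>2)" by blast
qed

lemma subgaussian_add:
  assumes "subgaussian f" "subgaussian g"
  shows "subgaussian (\<lambda>z. f z + g z)"
proof (rule subgaussianI)
  fix e :: real assume e: "e > 0"
  obtain K L where "\<And>z. cmod (f z) \<le> K * exp (e * (cmod z)\<^sup>2)" "\<And>z. cmod (g z) \<le> L * exp (e * (cmod z)\<^sup>2)"
    using subgaussianE[OF assms(1) e] subgaussianE[OF assms(2) e] by metis
  then have "cmod (f z + g z) \<le> (K + L) * exp (e * (cmod z)\<^sup>2)" for z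
    unfolding distrib_right by (intro order_trans[OF norm_triangle_ineq] add_mono)
  then show "\<exists>K. \<forall>z. cmod (f z + g z) \<le> K * exp (e * (cmod z)\<^sup>2)" by blast
qed

lemma subgaussian_mult:
  assumes "subgaussian f" "subgaussian g"
  shows "subgaussian (\<lambda>z. f z * g z)"
proof (rule subgaussianI)
  fix e :: real assume "e > 0"
  \<comment> \<open>Each factor receives half of the exponent.\<close>
  then have e: "e / 2 > 0" by simp
  obtain K L where K: "K \<ge> 0" "\<And>z. cmod (f z) \<le> K * exp (e / 2 * (cmod z)\<^sup>2)"
    and L: "\<And>z. cmod (g z) \<le> L * exp (e / 2 * (cmod z)\<^sup>2)"
    using subgaussianE[OF assms(1) e] subgaussianE[OF assms(2) e] by metis
  have "cmod (f z * g z) \<le> (K * L) * exp (e * (cmod z)\<^sup>2)" for z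
  proof -
    have "cmod (f z * g z) \<le> (K * exp (e / 2 * (cmod z)\<^sup>2)) * (L * exp (e / 2 * (cmod z)\<^sup>2))"
      unfolding norm_mult using K L by (intro mult_mono) auto
    also have "\<dots> = (K * L) * (exp (e / 2 * (cmod z)\<^sup>2) * exp (e / 2 * (cmod z)\<^sup>2))"
      by (simp only: mult_ac)
    finally show ?thesis
      by (simp add: mult_exp_exp)
  qed
  then show "\<exists>K. \<forall>z. cmod (f z * g z) \<le> K * exp (e * (cmod z)\<^sup>2)" by blast
qed

lemma subgaussian_compose_affine:
  assumes "subgaussian f"
  shows "subgaussian (\<lambda>z. f (a * z + b))"
proof (rule subgaussianI)
  fix e :: real assume e: "e > 0"
  \<comment> \<open>The squared modulus of \<open>a * z + b\<close> is at most twice the sum of the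
    two squares, so \<open>2 * d * (cmod a)\<^sup>2 \<le> e\<close> is required; the summand
    \<open>1\<close> keeps the denominator positive for \<open>a = 0\<close>.\<close>
  define d where "d = e / (2 * (cmod a)\<^sup>2 + 1)"
  have pos: "2 * (cmod a)\<^sup>2 + 1 > 0"
    by (simp add: add_nonneg_pos)
  then have d: "d > 0" "2 * d * (cmod a)\<^sup>2 \<le> e"
    using e by (simp_all add: d_def pos_divide_le_eq distrib_left)
  obtain K where K: "K \<ge> 0" "\<And>z. cmod (f z) \<le> K * exp (d * (cmod z)\<^sup>2)"
    using subgaussianE[OF assms d(1)] by metis
  have "cmod (f (a * z + b)) \<le> (K * exp (2 * d * (cmod b)\<^sup>2)) * exp (e * (cmod z)\<^sup>2)" for z
  proof -
    have "(cmod (a * z + b))\<^sup>2 \<le> (cmod (a * z) + cmod b)\<^sup>2"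
      by (intro power_mono norm_triangle_ineq) auto
    also have "\<dots> \<le> 2 * (cmod a)\<^sup>2 * (cmod z)\<^sup>2 + 2 * (cmod b)\<^sup>2"
      using sum_squares_bound[of "cmod (a * z)" "cmod b"]
      by (simp add: power2_sum norm_mult power_mult_distrib)
    finally have "d * (cmod (a * z + b))\<^sup>2 \<le> d * (2 * (cmod a)\<^sup>2 * (cmod z)\<^sup>2 + 2 * (cmod b)\<^sup>2)"
      using d(1) by simp
    also have "\<dots> \<le> e * (cmod z)\<^sup>2 + 2 * d * (cmod b)\<^sup>2"
      using mult_right_mono[OF d(2), of "(cmod z)\<^sup>2"] by (simp add: algebra_simps)
    finally have "K * exp (d * (cmod (a * z + b))\<^sup>2) \<le> K * exp (2 * d * (cmod b)\<^sup>2 + e * (cmod z)\<^sup>2)"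
      using K(1) by (intro mult_left_mono) auto
    with K(2)[of "a * z + b"] show ?thesis
      by (simp add: exp_add mult.assoc)
  qed
  then show "\<exists>K. \<forall>z. cmod (f (a * z + b)) \<le> K * exp (e * (cmod z)\<^sup>2)" by blast
qed

lemma subgaussian_polynomial: "subgaussian (\<lambda>z. \<Sum>k<n. a k * z ^ k)"
proof -
  have "subgaussian (\<lambda>z. z ^ k)" for k
    by (induction k) (auto intro: subgaussian_const subgaussian_mult subgaussian_id)
  then show ?thesis
    by (induction n) (simp_all add: subgaussian_const subgaussian_mult subgaussian_add)
qed

lemma subgaussian_imp_fock_space:
  assumes "subgaussian f" "f holomorphic_on UNIV"
  shows "f \<in> fock_space"
proof -
  obtain K where "\<And>z. cmod (f z) \<le> K * exp (1 / 4 * (cmod z)\<^sup>2)"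
    using subgaussianE[OF assms(1), of "1/4"] by auto
  then show ?thesis
    using assms(2) by (intro fock_spaceI_gaussian_bound[of f "1/4" K]) auto
qed

section \<open>Approximation by polynomials\<close>

text \<open>Dilation leaves room for an intermediate \<open>q\<close> between \<open>r\<close> and
  \<open>1\<close>. Cauchy's inequality on the circle of radius \<open>q * cmod z\<close> bounds the
  Taylor terms geometrically with ratio \<open>r / q\<close>, and the resulting majorant grows like
  \<open>exp (q\<^sup>2 / 2 * (cmod z)\<^sup>2)\<close>, which is square integrable because
  \<open>q < 1\<close>.\<close>

lemma fock_polynomial_approx_dilation:
  fixes r :: real
  assumes f: "f \<in> fock_space" and r: "0 < r" "r < 1"
  defines "a \<equiv> \<lambda>k. (deriv ^^ k) f 0 / fact k * of_real r ^ k"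
  shows "(\<lambda>n. fock_norm (\<lambda>z. (\<Sum>k<n. a k * z ^ k) - f (of_real r * z))) \<longlonglongrightarrow> 0"
proof -
  note [measurable] = fock_spaceD(3)[OF f]
  define q where "q = (1 + r) / 2"
  have q: "r < q" "q < 1" "0 < q"
    using r by (auto simp: q_def)
  have rq: "0 < r / q" "r / q < 1"
    using r q by auto
  define B where "B z = fock_norm f * exp (q\<^sup>2 / 2 * (cmod z)\<^sup>2)" for z
  have B: "B z \<ge> 0" for z
    by (simp add: B_def fock_norm_nonneg)
  have sums: "(\<lambda>k. a k * z ^ k) sums f (of_real r * z)" for z
  proof -
    have "(\<lambda>k. (deriv ^^ k) f 0 / fact k * (of_real r * z - 0) ^ k) sums f (of_real r * z)"
      by (rule holomorphic_power_series[where r = "cmod (of_real r * z) + 1"])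
         (use fock_spaceD(1)[OF f] in \<open>auto intro: holomorphic_on_subset\<close>)
    then show ?thesis
      by (simp add: a_def power_mult_distrib mult.assoc)
  qed
  have term_bound: "cmod (a k * z ^ k) \<le> B z * (r / q) ^ k" if "z \<noteq> 0" for k z
  proof -
    let ?\<rho> = "q * cmod z"
    have \<rho>: "?\<rho> > 0"
      using q that by simp
    have "cmod ((deriv ^^ k) f 0) \<le> fact k * B z / ?\<rho> ^ k"
    proof (rule Cauchy_inequality)
      show "f holomorphic_on ball 0 ?\<rho>" "continuous_on (cball 0 ?\<rho>) f"
        using fock_spaceD(1)[OF f] holomorphic_on_imp_continuous_on
        by (auto intro: holomorphic_on_subset)
      show "cmod (f x) \<le> B z" if "cmod (0 - x) = ?\<rho>" for x
        using fock_growth[OF f, of x] that by (simp add: B_def power_mult_distrib)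
    qed (rule \<rho>)
    then have "cmod ((deriv ^^ k) f 0) / fact k * (r * cmod z) ^ k \<le> B z / ?\<rho> ^ k * (r * cmod z) ^ k"
      using r by (intro mult_right_mono) (auto simp: field_simps)
    also have "\<dots> = B z * (r / q) ^ k"
      using that q by (simp add: power_mult_distrib power_divide)
    finally show ?thesis
      using r by (simp add: a_def norm_mult norm_divide norm_power power_mult_distrib mult.assoc)
  qed
  define K where "K = 1 / (1 - r / q)"
  have part_bound: "cmod (\<Sum>k<n. a k * z ^ k) \<le> B z * K" if "z \<noteq> 0" for n z
  proof -
    have "cmod (\<Sum>k<n. a k * z ^ k) \<le> (\<Sum>k<n. B z * (r / q) ^ k)"
      by (rule order_trans[OF norm_sum sum_mono[OF term_bound[OF that]]])
    also have "\<dots> = B z * (\<Sum>k<n. (r / q) ^ k)"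
      by (simp add: sum_distrib_left)
    also have "\<dots> \<le> B z * (\<Sum>k. (r / q) ^ k)"
      using rq by (intro mult_left_mono sum_le_suminf summable_geometric B) auto
    also have "\<dots> = B z * K"
      using rq by (simp add: suminf_geometric K_def)
    finally show ?thesis .
  qed
  have lim_bound: "cmod (f (of_real r * z)) \<le> B z * K" if "z \<noteq> 0" for z
    using sums[of z] part_bound[OF that] unfolding sums_def
    by (intro LIMSEQ_le_const2[OF tendsto_norm]) auto
  have "(\<lambda>n. \<integral>z. (cmod ((\<Sum>k<n. a k * z ^ k) - f (of_real r * z)))\<^sup>2 \<partial>fock_measure) \<longlonglongrightarrow> (\<integral>z. 0 \<partial>fock_measure)"
  proof (rule integral_dominated_convergence)
    have "q\<^sup>2 < 1"
      using q by (simp add: power_less_one_iff abs_square_less_1)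
    then have "integrable fock_measure (\<lambda>z. (2 * (fock_norm f * K))\<^sup>2 * exp (q\<^sup>2 * (cmod z)\<^sup>2))"
      by (intro integrable_mult_right integrable_fock_gaussian)
    moreover have "(2 * (B z * K))\<^sup>2 = (2 * (fock_norm f * K))\<^sup>2 * exp (q\<^sup>2 * (cmod z)\<^sup>2)" for z
      by (simp add: B_def power_mult_distrib flip: exp_double)
    ultimately show "integrable fock_measure (\<lambda>z. (2 * (B z * K))\<^sup>2)"
      by simp
    \<comment> \<open>The estimates exclude the origin, where the circle degenerates; it is a null
      set.\<close>
    have "AE z in lborel. z \<noteq> (0::complex)"
      by (rule AE_lborel_singleton)
    then have nz: "AE z in fock_measure. z \<noteq> 0"
      unfolding fock_measure_def by (subst AE_density) (auto elim: eventually_mono)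
    show "AE z in fock_measure. norm ((cmod ((\<Sum>k<n. a k * z ^ k) - f (of_real r * z)))\<^sup>2) \<le> (2 * (B z * K))\<^sup>2" for n
      using nz
    proof eventually_elim
      case (elim z)
      have "cmod ((\<Sum>k<n. a k * z ^ k) - f (of_real r * z)) \<le> B z * K + B z * K"
        by (rule order_trans[OF norm_triangle_ineq4 add_mono[OF part_bound lim_bound]]) fact+
      then have "(cmod ((\<Sum>k<n. a k * z ^ k) - f (of_real r * z)))\<^sup>2 \<le> (2 * (B z * K))\<^sup>2"
        by (intro power_mono) (simp_all add: mult.commute)
      then show ?case
        by (simp only: real_norm_def abs_power2)
    qed
    have "(\<lambda>n. (cmod ((\<Sum>k<n. a k * z ^ k) - f (of_real r * z)))\<^sup>2)
        \<longlonglongrightarrow> (cmod (f (of_real r * z) - f (of_real r * z)))\<^sup>2" for z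
      using sums[of z] unfolding sums_def by (intro tendsto_intros)
    then show "AE z in fock_measure. (\<lambda>n. (cmod ((\<Sum>k<n. a k * z ^ k) - f (of_real r * z)))\<^sup>2) \<longlonglongrightarrow> 0"
      by simp
  qed measurable
  then have "(\<lambda>n. sqrt ((fock_norm (\<lambda>z. (\<Sum>k<n. a k * z ^ k) - f (of_real r * z)))\<^sup>2)) \<longlonglongrightarrow> sqrt 0"
    by (intro tendsto_real_sqrt) (simp add: fock_norm_power2)
  then show ?thesis
    by (simp add: fock_norm_nonneg)
qed

lemma fock_norm_diff_commute: "fock_norm (\<lambda>z. f z - g z) = fock_norm (\<lambda>z. g z - f z)"
  unfolding fock_norm_def fock_inner_self by (simp add: norm_minus_commute)

lemma fock_norm_triangle:
  assumes f: "f \<in> fock_space" and g: "g \<in> fock_space"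
  shows "fock_norm (\<lambda>z. f z + g z) \<le> fock_norm f + fock_norm g"
proof (rule power2_le_imp_le)
  have h: "(\<lambda>z. f z + g z) \<in> fock_space"
    using fock_space_lincomb[OF f g, of 1 1] by simp
  have sq: "complex_of_real ((fock_norm k)\<^sup>2) = fock_inner k k" for k
    by (simp add: fock_norm_power2 fock_inner_self)
  have "fock_inner (\<lambda>z. f z + g z) (\<lambda>z. f z + g z)
      = fock_inner f f + fock_inner f g + (fock_inner g f + fock_inner g g)"
    unfolding fock_inner_def using f g by (simp add: distrib_left distrib_right integrable_fock_inner)
  then have "Re (fock_inner (\<lambda>z. f z + g z) (\<lambda>z. f z + g z))
      = Re (fock_inner f f) + 2 * Re (fock_inner f g) + Re (fock_inner g g)"
    by (simp add: fock_inner_commute[of g f])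
  then have "(fock_norm (\<lambda>z. f z + g z))\<^sup>2 = (fock_norm f)\<^sup>2 + 2 * Re (fock_inner f g) + (fock_norm g)\<^sup>2"
    by (simp only: sq[symmetric] Re_complex_of_real)
  also have "\<dots> \<le> (fock_norm f + fock_norm g)\<^sup>2"
    using order_trans[OF complex_Re_le_cmod fock_Cauchy_Schwarz[OF f g]] by (simp add: power2_sum)
  finally show "(fock_norm (\<lambda>z. f z + g z))\<^sup>2 \<le> (fock_norm f + fock_norm g)\<^sup>2" .
qed (simp add: fock_norm_nonneg)

text \<open>First dilate, then truncate the Taylor series of the dilated function; each error takes
  half of \<open>e\<close>.\<close>

lemma fock_polynomials_dense:
  assumes f: "f \<in> fock_space" and e: "e > 0"
  obtains a n where "fock_norm (\<lambda>z. f z - (\<Sum>k<n. a k * z ^ k)) < e"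
proof -
  \<comment> \<open>The summand \<open>2\<close> keeps \<open>r m\<close> positive already for
    \<open>m = 0\<close>.\<close>
  define r where "r m = 1 - 1 / (real m + 2)" for m
  have r: "0 < r m" "r m < 1" for m
    by (auto simp: r_def field_simps)
  have r_lim: "r \<longlonglongrightarrow> 1"
    unfolding r_def by real_asymp
  obtain m where m: "fock_norm (\<lambda>z. f (of_real (r m) * z) - f z) < e / 2"
    using order_tendstoD(2)[OF fock_dilation_tendsto(2)[OF f r r_lim], of "e / 2"] e
    by (auto simp: eventually_sequentially)
  define a where "a k = (deriv ^^ k) f 0 / fact k * of_real (r m) ^ k" for k
  obtain n where n: "fock_norm (\<lambda>z. (\<Sum>k<n. a k * z ^ k) - f (of_real (r m) * z)) < e / 2"
    using order_tendstoD(2)[OF fock_polynomial_approx_dilation[OF f r], of "e / 2" m] e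
    by (auto simp: eventually_sequentially a_def)
  define p where "p z = (\<Sum>k<n. a k * z ^ k)" for z
  have p: "p \<in> fock_space"
    unfolding p_def
    by (intro subgaussian_imp_fock_space subgaussian_polynomial holomorphic_intros)
  have "fock_norm (\<lambda>z. (f z - f (of_real (r m) * z)) + (f (of_real (r m) * z) - p z)) < e / 2 + e / 2"
  proof (intro le_less_trans[OF fock_norm_triangle] add_strict_mono fock_space_diff f p)
    show "fock_norm (\<lambda>z. f z - f (of_real (r m) * z)) < e / 2"
      using m by (subst fock_norm_diff_commute)
    show "fock_norm (\<lambda>z. f (of_real (r m) * z) - p z) < e / 2"
      using n unfolding p_def by (subst fock_norm_diff_commute)
  qed (rule fock_dilation_tendsto(1)[OF f r r_lim])+
  then show ?thesis
    using that[of a n] by (simp add: p_def)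
qed

section \<open>Weighted composition operators\<close>

lemma fock_operator_W_max: "fock_operator (W_max \<psi> \<phi>)"
proof -
  have zero: "weighted_comp \<psi> \<phi> (\<lambda>_. 0) = (\<lambda>_. 0)"
    by (simp add: weighted_comp_def)
  have lin: "weighted_comp \<psi> \<phi> (\<lambda>z. a * f z + b * g z)
      = (\<lambda>z. a * weighted_comp \<psi> \<phi> f z + b * weighted_comp \<psi> \<phi> g z)" for a b f g
    by (simp add: weighted_comp_def fun_eq_iff algebra_simps)
  show ?thesis
    unfolding fock_operator_def
    by (auto simp: W_max_def dom_def ran_def zero lin fock_space_zero fock_space_lincomb split: if_splits)
qed

text \<open>Norm convergence implies pointwise convergence and the operator acts pointwise, so the
  limit \<open>g\<close> must be the weighted composition of \<open>f\<close>; maximality of the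
  domain does the rest.\<close>

lemma closed_op_W_max: "closed_op (W_max \<psi> \<phi>)"
  unfolding closed_op_def
proof (intro allI ballI impI)
  fix F G f g
  assume f: "f \<in> fock_space" and g: "g \<in> fock_space"
    and FG: "\<forall>n::nat. W_max \<psi> \<phi> (F n) = Some (G n)"
    and F_lim: "(\<lambda>n. fock_norm (\<lambda>z. F n z - f z)) \<longlonglongrightarrow> 0"
    and G_lim: "(\<lambda>n. fock_norm (\<lambda>z. G n z - g z)) \<longlonglongrightarrow> 0"
  have FG': "F n \<in> fock_space" "G n \<in> fock_space" "G n = weighted_comp \<psi> \<phi> (F n)" for n
    using FG[rule_format, of n] by (auto simp: W_max_def split: if_splits)
  have "g z = \<psi> z * f (\<phi> z)" for z
  proof (rule LIMSEQ_unique)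
    show "(\<lambda>n. G n z) \<longlonglongrightarrow> g z"
      by (rule fock_tendsto_imp_pointwise[OF FG'(2) g G_lim])
    show "(\<lambda>n. G n z) \<longlonglongrightarrow> \<psi> z * f (\<phi> z)"
      unfolding FG'(3) weighted_comp_def by (intro tendsto_intros fock_tendsto_imp_pointwise[OF FG'(1) f F_lim])
  qed
  then have "g = weighted_comp \<psi> \<phi> f"
    by (simp add: weighted_comp_def fun_eq_iff)
  with f g show "W_max \<psi> \<phi> f = Some g"
    by (simp add: W_max_def)
qed

section \<open>Adjoint vectors and the action of the adjoint on kernels\<close>

text \<open>The difference \<open>d\<close> is orthogonal to the domain. Were it nonzero, an
  \<open>f\<close> in the domain closer to \<open>d\<close> than \<open>fock_norm d\<close> would
  contradict Cauchy-Schwarz for the inner product of \<open>d - f\<close> with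
  \<open>d\<close>.\<close>

lemma adjoint_pair_unique:
  assumes T: "densely_defined T" "dom T \<subseteq> fock_space"
    and h1: "adjoint_pair T g h1" and h2: "adjoint_pair T g h2"
  shows "h1 = h2"
proof -
  define d where "d z = h1 z - h2 z" for z
  have h: "h1 \<in> fock_space" "h2 \<in> fock_space"
    using h1 h2 by (auto simp: adjoint_pair_def)
  then have d: "d \<in> fock_space"
    unfolding d_def by (rule fock_space_diff)
  have orth: "fock_inner f d = 0" if f: "f \<in> dom T" for f
  proof -
    have "fock_inner f h1 = fock_inner f h2"
      using f h1 h2 by (auto simp: adjoint_pair_def)
    then show ?thesis
      unfolding d_def using f T(2) h by (subst fock_inner_diff_right) auto
  qed
  have "fock_norm d = 0"
  proof (rule ccontr)
    assume "fock_norm d \<noteq> 0"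
    then have pos: "fock_norm d > 0"
      using fock_norm_nonneg[of d] by simp
    then obtain f where f: "f \<in> dom T" "fock_norm (\<lambda>z. d z - f z) < fock_norm d"
      using T(1) d unfolding densely_defined_def by blast
    have "(fock_norm d)\<^sup>2 = cmod (fock_inner d d)"
      by (simp add: fock_inner_self fock_norm_power2)
    also have "fock_inner d d = fock_inner (\<lambda>z. d z - f z) d"
      using f(1) T(2) d orth by (subst fock_inner_diff_left) auto
    also have "cmod \<dots> \<le> fock_norm (\<lambda>z. d z - f z) * fock_norm d"
      using f(1) T(2) d by (intro fock_Cauchy_Schwarz fock_space_diff) auto
    also have "\<dots> < fock_norm d * fock_norm d"
      using f(2) pos by simp
    finally show False
      by (simp add: power2_eq_square)
  qed
  then have "d z = 0" for z
    using fock_growth[OF d, of z] by simp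
  then show ?thesis
    by (simp add: d_def fun_eq_iff)
qed

text \<open>Both inner products are point evaluations, equal to
  \<open>\<psi> w * f (\<phi> w)\<close>.\<close>

lemma adjoint_pair_kernel:
  "adjoint_pair (W_max \<psi> \<phi>) (fock_kernel w) (\<lambda>z. cnj (\<psi> w) * fock_kernel (\<phi> w) z)"
  unfolding adjoint_pair_def
proof (intro conjI allI impI fock_kernel_in_fock_space fock_space_cmult)
  fix f Tf assume "W_max \<psi> \<phi> f = Some Tf"
  then have *: "f \<in> fock_space" "Tf \<in> fock_space" "Tf = weighted_comp \<psi> \<phi> f"
    by (auto simp: W_max_def split: if_splits)
  show "fock_inner Tf (fock_kernel w) = fock_inner f (\<lambda>z. cnj (\<psi> w) * fock_kernel (\<phi> w) z)"
    unfolding fock_inner_cmult_right fock_reproducing[OF *(1)] fock_reproducing[OF *(2)]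
    by (simp add: *(3) weighted_comp_def)
qed

text \<open>Density makes the adjoint at a kernel the vector found above; the extension hypothesis
  forces the operator to take the same value there. The identity compares the two at
  \<open>z\<close>.\<close>

lemma adjoint_extended_imp_kernel_identity:
  assumes dense: "densely_defined (W_max \<psi> \<phi>)"
    and le: "op_adjoint (W_max \<psi> \<phi>) \<subseteq>\<^sub>m W_max \<psi> \<phi>"
  shows "\<psi> z * exp (cnj w * \<phi> z) = cnj (\<psi> w) * exp (cnj (\<phi> w) * z)"
proof -
  let ?T = "W_max \<psi> \<phi>" and ?h = "\<lambda>z. cnj (\<psi> w) * fock_kernel (\<phi> w) z"
  have dom: "dom ?T \<subseteq> fock_space"
    using fock_operator_W_max by (simp add: fock_operator_def)
  have "(THE h. adjoint_pair ?T (fock_kernel w) h) = ?h"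
    by (intro the_equality adjoint_pair_kernel adjoint_pair_unique[OF dense dom _ adjoint_pair_kernel])
  then have "op_adjoint ?T (fock_kernel w) = Some ?h"
    using adjoint_pair_kernel by (auto simp: op_adjoint_def)
  then have "?T (fock_kernel w) = Some ?h"
    using le by (auto simp: map_le_def dom_def)
  then have "weighted_comp \<psi> \<phi> (fock_kernel w) = ?h"
    by (simp add: W_max_def split: if_splits)
  from fun_cong[OF this, of z] show ?thesis
    by (simp add: weighted_comp_def fock_kernel_def)
qed

section \<open>Determination of the symbols\<close>

text \<open>Differentiating \<open>exp (k z) = 1\<close> gives \<open>k' = 0\<close>, as the
  exponential never vanishes.\<close>

lemma entire_exp_eq_1_imp_const:
  assumes k: "k holomorphic_on UNIV" and exp_k: "\<And>z. exp (k z) = 1"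
  shows "k z = k 0"
proof -
  have "(k has_field_derivative 0) (at x)" for x
  proof -
    have der: "(k has_field_derivative deriv k x) (at x)"
      using holomorphic_derivI[OF k] by simp
    have "((\<lambda>z. exp (k z)) has_field_derivative exp (k x) * deriv k x) (at x)"
      using DERIV_fun_exp[OF der] .
    moreover have "((\<lambda>z. exp (k z)) has_field_derivative 0) (at x)"
      by (simp add: exp_k)
    ultimately have "exp (k x) * deriv k x = 0"
      by (rule DERIV_unique)
    then have "deriv k x = 0"
      by simp
    with der show ?thesis by simp
  qed
  then have "\<exists>c. \<forall>x\<in>UNIV. k x = c"
    by (intro has_field_derivative_zero_constant convex_UNIV)
  then show ?thesis by auto
qed

lemma kernel_identity_imp_form:
  assumes \<phi>: "\<phi> holomorphic_on UNIV" and nz: "\<exists>z. \<psi> z \<noteq> 0"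
    and id: "\<And>z w. \<psi> z * exp (cnj w * \<phi> z) = cnj (\<psi> w) * exp (cnj (\<phi> w) * z)"
  shows "\<exists>(A::real) (C::real) (B::complex). C \<noteq> 0 \<and>
           (\<forall>z. \<phi> z = of_real A * z + B) \<and> (\<forall>z. \<psi> z = of_real C * exp (cnj B * z))"
proof -
  define B where "B = \<phi> 0"
  define C where "C = Re (\<psi> 0)"
  define A where "A = Re (\<phi> 1 - B)"
  \<comment> \<open>The identity at \<open>z = w = 0\<close> makes \<open>\<psi> 0\<close> real;
    with \<open>w = 0\<close> and \<open>z\<close> free it then determines
    \<open>\<psi>\<close>.\<close>
  have "\<psi> 0 = cnj (\<psi> 0)"
    using id[of 0 0] by simp
  then have C: "\<psi> 0 = of_real C"
    by (simp add: C_def complex_eq_iff)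
  have \<psi>: "\<psi> z = of_real C * exp (cnj B * z)" for z
    using id[of z 0] by (simp add: C B_def)
  have C0: "C \<noteq> 0"
    using nz \<psi> by auto
  \<comment> \<open>The difference of the two exponents in the identity at \<open>w = 1\<close>. Its
    exponential is \<open>1\<close> and \<open>k 0 = 0\<close>, so \<open>k\<close> vanishes and
    \<open>\<phi>\<close> is affine.\<close>
  define k where "k z = \<phi> z - B - cnj (\<phi> 1 - B) * z" for z
  have "exp (k z) = 1" for z
  proof -
    have "of_real C * (exp (cnj B * z) * exp (\<phi> z)) = of_real C * (exp B * exp (cnj (\<phi> 1) * z))"
      using id[of z 1] by (simp add: \<psi> exp_cnj mult.assoc)
    then have "exp (cnj B * z + \<phi> z) = exp (B + cnj (\<phi> 1) * z)"
      using C0 by (simp add: exp_add)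
    moreover have "k z = (cnj B * z + \<phi> z) - (B + cnj (\<phi> 1) * z)"
      by (simp add: k_def algebra_simps)
    ultimately show ?thesis
      by (simp add: exp_diff)
  qed
  moreover have "k holomorphic_on UNIV"
    unfolding k_def by (intro holomorphic_intros \<phi>)
  ultimately have k0: "k z = 0" for z
    using entire_exp_eq_1_imp_const[of k z] by (simp add: k_def B_def)
  \<comment> \<open>Evaluation at \<open>z = 1\<close> shows that the slope equals its own
    conjugate.\<close>
  have "\<phi> 1 - B = cnj (\<phi> 1 - B)"
    using k0[of 1] by (simp add: k_def)
  then have "\<phi> 1 - B = of_real A"
    by (simp add: A_def complex_eq_iff)
  then have "\<phi> z = of_real A * z + B" for z
    using k0[of z] by (simp add: k_def algebra_simps)
  with \<psi> C0 show ?thesis by blast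
qed

section \<open>Symmetry for affine symbols\<close>

text \<open>Supplies the uniform bound for the dilation argument in the unimodular case. The point
  \<open>(1 - t) * z - t * p\<close> is a convex combination of \<open>z\<close> and
  \<open>- p\<close>, so strict convexity of the squared modulus gains at least \<open>t / 2\<close>
  times the squared modulus of \<open>z + p\<close>. Absorbing the linear term with parameter
  \<open>1 / 4\<close> costs exactly that much.\<close>

lemma cmod_dilation_bound:
  fixes t :: real
  assumes t: "0 \<le> t" "t \<le> 1 / 2"
  shows "2 * t * Re (cnj B * (z + p)) + (cmod (of_real (1 - t) * z - of_real t * p))\<^sup>2
       \<le> 2 * (cmod B)\<^sup>2 + (cmod p)\<^sup>2 + (cmod z)\<^sup>2"
proof -
  have id: "(cmod (of_real (1 - t) * z - of_real t * p))\<^sup>2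
      = (1 - t) * (cmod z)\<^sup>2 + t * (cmod p)\<^sup>2 - (1 - t) * t * (cmod (z + p))\<^sup>2"
    unfolding cmod_power2 by (simp add: power2_eq_square algebra_simps)
  have "Re (cnj B * (z + p)) \<le> cmod B * cmod (z + p)"
    using complex_Re_le_cmod[of "cnj B * (z + p)"] by (simp add: norm_mult)
  also have "\<dots> \<le> (cmod B)\<^sup>2 + 1 / 4 * (cmod (z + p))\<^sup>2"
    using linear_le_quadratic[of "1/4" "cmod B" "cmod (z + p)"] by simp
  finally have 1: "2 * t * Re (cnj B * (z + p)) \<le> 2 * t * ((cmod B)\<^sup>2 + 1 / 4 * (cmod (z + p))\<^sup>2)"
    using t by (intro mult_left_mono) auto
  have 2: "1 / 2 * t * (cmod (z + p))\<^sup>2 \<le> (1 - t) * t * (cmod (z + p))\<^sup>2"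
    using t by (intro mult_right_mono) auto
  have 3: "2 * t * (cmod B)\<^sup>2 \<le> 2 * 1 * (cmod B)\<^sup>2" "t * (cmod p)\<^sup>2 \<le> 1 * (cmod p)\<^sup>2"
      "(1 - t) * (cmod z)\<^sup>2 \<le> 1 * (cmod z)\<^sup>2"
    using t by (intro mult_right_mono; simp)+
  show ?thesis
    using 1 2 3 unfolding id by (simp add: algebra_simps)
qed

text \<open>Scaling slope and shift of \<open>f\<close> by \<open>1 - t n\<close> gives
  \<open>V n\<close>, to which the contractive adjoint formula applies; the other side is then a
  dilation of \<open>E g\<close>. As \<open>V n\<close> can also be written through
  \<open>E f\<close>, both sides converge in norm.\<close>

lemma affine_symmetric_unimodular:
  fixes A :: real and B :: complex
  assumes A: "\<bar>A\<bar> = 1" and f: "f \<in> fock_space" and g: "g \<in> fock_space"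
  defines "E \<equiv> \<lambda>f z. exp (cnj B * z) * f (of_real A * z + B)"
  assumes Ef: "E f \<in> fock_space" and Eg: "E g \<in> fock_space"
  shows "fock_inner (E f) g = fock_inner f (E g)"
proof -
  \<comment> \<open>The summand \<open>2\<close> ensures \<open>t n \<le> 1 / 2\<close>, as the
    dilation bound requires.\<close>
  define t where "t n = 1 / (real n + 2)" for n
  \<comment> \<open>With \<open>of_real A * p = B\<close>, the shift \<open>c n\<close> sends the
    argument of \<open>f\<close> inside \<open>E f\<close> to the scaled one, and
    \<open>\<psi> n\<close> restores the factor \<open>exp (cnj B * z)\<close>.\<close>
  define p where "p = B / of_real A"
  define \<psi> where "\<psi> n z = exp (cnj B * (of_real (t n) * (z + p)))" for n z
  define c where "c n = - (of_real (t n) * p)" for n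
  have A0: "A \<noteq> 0"
    using A by auto
  have t: "0 < t n" "t n \<le> 1 / 2" for n
    by (auto simp: t_def field_simps)
  have t_lim: "t \<longlonglongrightarrow> 0" and r_lim: "(\<lambda>n. 1 - t n) \<longlonglongrightarrow> 1"
    unfolding t_def by real_asymp+
  have c_lim: "c \<longlonglongrightarrow> 0"
    unfolding c_def using tendsto_minus[OF tendsto_mult[OF tendsto_of_real[OF t_lim] tendsto_const[of p]]] by simp
  have \<psi>: "\<psi> n holomorphic_on UNIV" for n
    unfolding \<psi>_def by (intro holomorphic_intros)
  have "(\<lambda>n. \<psi> n z) \<longlonglongrightarrow> exp (cnj B * (of_real 0 * (z + p)))" for z
    unfolding \<psi>_def by (intro tendsto_intros t_lim)
  then have \<psi>_lim: "(\<lambda>n. \<psi> n z) \<longlonglongrightarrow> 1" for z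
    by simp
  have bound: "cmod (\<psi> n z) ^ 2 * exp ((cmod (of_real (1 - t n) * z + c n))\<^sup>2)
      \<le> exp (2 * (cmod B)\<^sup>2 + (cmod p)\<^sup>2) * exp ((cmod z)\<^sup>2)" for n z
  proof -
    have "Re (cnj B * (of_real (t n) * (z + p))) = t n * Re (cnj B * (z + p))"
      by (simp add: algebra_simps)
    then show ?thesis
      using cmod_dilation_bound[of "t n" B z p] t[of n]
      by (simp add: \<psi>_def c_def norm_exp_eq_Re mult_exp_exp mult.assoc flip: exp_double)
  qed
  have r: "0 < 1 - t n" "1 - t n < 1" "1 - t n \<noteq> 0" for n
    using t[of n] by auto
  define V where "V n z = \<psi> n z * E f (of_real (1 - t n) * z + c n)" for n z
  have V: "V n \<in> fock_space" "(\<lambda>n. fock_norm (\<lambda>z. V n z - E f z)) \<longlonglongrightarrow> 0" for n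
    unfolding V_def
    by (rule fock_weighted_comp_tendsto[OF Ef \<psi> bound r(3) r_lim c_lim \<psi>_lim])+
  have D: "(\<lambda>z. E g (of_real (1 - t n) * z)) \<in> fock_space"
    "(\<lambda>n. fock_norm (\<lambda>z. E g (of_real (1 - t n) * z) - E g z)) \<longlonglongrightarrow> 0" for n
    by (rule fock_dilation_tendsto[OF Eg r(1,2) r_lim])+
  have V_eq: "V n z = exp (cnj B * z) * f (of_real ((1 - t n) * A) * z + of_real (1 - t n) * B)" for n z
  proof -
    have "of_real A * (of_real (1 - t n) * z + c n) + B = of_real ((1 - t n) * A) * z + of_real (1 - t n) * B"
      using A0 by (simp add: c_def p_def algebra_simps)
    moreover have "cnj B * (of_real (t n) * (z + p)) + cnj B * (of_real (1 - t n) * z + c n) = cnj B * z"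
      by (simp add: c_def algebra_simps)
    ultimately show ?thesis
      by (simp only: V_def \<psi>_def E_def mult.assoc[symmetric] mult_exp_exp)
  qed
  have "\<bar>(1 - t n) * A\<bar> < 1" for n
    using r[of n] A by (simp add: abs_mult)
  then have "fock_inner (V n) g
      = fock_inner f (\<lambda>z. exp (cnj (of_real (1 - t n) * B) * z) * g (of_real ((1 - t n) * A) * z + B))" for n
    unfolding V_eq[abs_def] by (rule fock_weighted_comp_adjoint[OF f g])
  moreover have "(\<lambda>z. exp (cnj (of_real (1 - t n) * B) * z) * g (of_real ((1 - t n) * A) * z + B))
      = (\<lambda>z. E g (of_real (1 - t n) * z))" for n
    by (simp add: E_def mult_ac)
  ultimately have eq: "fock_inner (V n) g = cnj (fock_inner (\<lambda>z. E g (of_real (1 - t n) * z)) f)" for n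
    by (simp only: fock_inner_commute[of f, symmetric])
  have "(\<lambda>n. fock_inner (V n) g) \<longlonglongrightarrow> fock_inner (E f) g"
    by (rule fock_inner_tendsto[OF V(1) Ef g V(2)])
  moreover have "(\<lambda>n. fock_inner (V n) g) \<longlonglongrightarrow> cnj (fock_inner (E g) f)"
    unfolding eq by (intro tendsto_cnj fock_inner_tendsto[OF D(1) Eg f D(2)])
  ultimately have "fock_inner (E f) g = cnj (fock_inner (E g) f)"
    by (rule LIMSEQ_unique)
  then show ?thesis
    by (simp only: fock_inner_commute[of f, symmetric])
qed

lemma affine_symmetric:
  fixes A :: real and B :: complex
  assumes f: "f \<in> fock_space" and g: "g \<in> fock_space"
  defines "E \<equiv> \<lambda>f z. exp (cnj B * z) * f (of_real A * z + B)"
  assumes Ef: "E f \<in> fock_space" and Eg: "E g \<in> fock_space"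
  shows "fock_inner (E f) g = fock_inner f (E g)"
proof -
  consider "\<bar>A\<bar> < 1" | "\<bar>A\<bar> = 1" | "\<bar>A\<bar> > 1" by linarith
  then show ?thesis
  proof cases
    case 1
    then show ?thesis
      unfolding E_def by (rule fock_weighted_comp_adjoint[OF f g])
  next
    case 2
    then show ?thesis
      using Ef Eg unfolding E_def by (intro affine_symmetric_unimodular[OF _ f g])
  next
    case 3
    \<comment> \<open>Up to the factor \<open>\<kappa>\<close>, the inverse of \<open>E\<close> is of the same form with \<open>1 / A\<close> in place of \<open>A\<close>.\<close>
    define b where "b = - B / of_real A"
    define \<kappa> where "\<kappa> = exp (- ((cmod B)\<^sup>2 / A))"
    have inv: "exp (cnj b * z) * E h (of_real (1 / A) * z + b) = of_real \<kappa> * h z" for h z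
    proof -
      have arg: "of_real A * (of_real (1 / A) * z + b) + B = z"
        using 3 by (simp add: b_def algebra_simps)
      have "cnj b * z + cnj B * (of_real (1 / A) * z + b) = of_real (- ((cmod B)\<^sup>2 / A))"
        using 3 by (simp only: of_real_minus of_real_divide complex_norm_square) (simp add: b_def field_simps)
      then have "exp (cnj b * z) * exp (cnj B * (of_real (1 / A) * z + b)) = of_real \<kappa>"
        by (simp only: mult_exp_exp \<kappa>_def exp_of_real)
      then show ?thesis
        unfolding E_def arg by (simp only: mult.assoc[symmetric])
    qed
    have "\<bar>1 / A\<bar> < 1"
      using 3 by simp
    \<comment> \<open>By \<open>inv\<close> the two sides are \<open>\<kappa>\<close> times the
      inner products of \<open>f\<close> with \<open>E g\<close> and of \<open>E f\<close> with
      \<open>g\<close>; being real and nonzero, \<open>\<kappa>\<close> cancels.\<close>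
    then have "fock_inner (\<lambda>z. exp (cnj b * z) * E f (of_real (1 / A) * z + b)) (E g)
        = fock_inner (E f) (\<lambda>z. exp (cnj b * z) * E g (of_real (1 / A) * z + b))"
      by (rule fock_weighted_comp_adjoint[OF Ef Eg])
    then show ?thesis
      unfolding inv fock_inner_cmult_left fock_inner_cmult_right by (simp add: \<kappa>_def)
  qed
qed

section \<open>Self-adjointness for affine symbols, and the equivalence\<close>

text \<open>The core is \<open>pair\<close>, which identifies the adjoint pairs with the graph of
  the operator. Since a graph is single-valued, \<open>op_adjoint\<close> then returns the operator
  itself, with the same domain.\<close>

lemma affine_imp_hermitian:
  fixes A C :: real
  assumes C: "C \<noteq> 0"
    and \<phi>: "\<And>z. \<phi> z = of_real A * z + B"
    and \<psi>: "\<And>z. \<psi> z = of_real C * exp (cnj B * z)"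
  shows "hermitian_op (W_max \<psi> \<phi>)"
proof -
  let ?T = "W_max \<psi> \<phi>"
  define E where "E f z = exp (cnj B * z) * f (of_real A * z + B)" for f z
  have wc: "weighted_comp \<psi> \<phi> f = (\<lambda>z. of_real C * E f z)" for f
    by (simp add: weighted_comp_def \<phi> \<psi> E_def mult.assoc)
  have "(\<lambda>z. of_real C * E f z) \<in> fock_space \<longleftrightarrow> E f \<in> fock_space" for f
    using fock_space_cmult[of "E f" "of_real C"] fock_space_cmult[of "\<lambda>z. of_real C * E f z" "1 / of_real C"] C
    by auto
  then have T: "?T f = Some h \<longleftrightarrow> f \<in> fock_space \<and> E f \<in> fock_space \<and> h = (\<lambda>z. of_real C * E f z)" for f h
    by (auto simp: W_max_def wc)
  \<comment> \<open>Serves twice: polynomials in the domain give density, kernels in the domain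
    serve as test vectors.\<close>
  have sub_dom: "?T f = Some (\<lambda>z. of_real C * E f z)" if f: "subgaussian f" "f holomorphic_on UNIV" for f
  proof -
    have "E f \<in> fock_space"
      unfolding E_def
    proof (rule subgaussian_imp_fock_space)
      show "subgaussian (\<lambda>z. exp (cnj B * z) * f (of_real A * z + B))"
        by (rule subgaussian_mult[OF subgaussian_exp_linear subgaussian_compose_affine[OF f(1)]])
      show "(\<lambda>z. exp (cnj B * z) * f (of_real A * z + B)) holomorphic_on UNIV"
        by (intro holomorphic_on_mult entire_compose[OF f(2)] holomorphic_intros)
    qed
    then show ?thesis
      unfolding T using subgaussian_imp_fock_space[OF f] by simp
  qed
  have "densely_defined ?T"
    unfolding densely_defined_def
  proof (intro ballI allI impI)
    fix f and e :: real assume "f \<in> fock_space" "e > 0"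
    then obtain a n where "fock_norm (\<lambda>z. f z - (\<Sum>k<n. a k * z ^ k)) < e"
      by (rule fock_polynomials_dense)
    moreover have "(\<lambda>z. \<Sum>k<n. a k * z ^ k) \<in> dom ?T"
      by (rule domI, rule sub_dom[OF subgaussian_polynomial]) (intro holomorphic_intros)
    ultimately show "\<exists>g\<in>dom ?T. fock_norm (\<lambda>z. f z - g z) < e"
      by (rule bexI[where x = "\<lambda>z. \<Sum>k<n. a k * z ^ k"])
  qed
  moreover have pair: "adjoint_pair ?T g h \<longleftrightarrow> ?T g = Some h" for g h
  proof
    assume "?T g = Some h"
    then have g: "g \<in> fock_space" "E g \<in> fock_space" "h = (\<lambda>z. of_real C * E g z)"
      unfolding T by auto
    have "fock_inner Tf g = fock_inner f h" if "?T f = Some Tf" for f Tf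
    proof -
      have f: "f \<in> fock_space" "E f \<in> fock_space" "Tf = (\<lambda>z. of_real C * E f z)"
        using that unfolding T by auto
      have "fock_inner (E f) g = fock_inner f (E g)"
        using f(2) g(2) unfolding E_def[abs_def] by (rule affine_symmetric[OF f(1) g(1)])
      then show ?thesis
        unfolding f(3) g(3) by (simp add: fock_inner_cmult_left fock_inner_cmult_right)
    qed
    then show "adjoint_pair ?T g h"
      using g by (simp add: adjoint_pair_def fock_space_cmult)
  next
    assume *: "adjoint_pair ?T g h"
    then have g: "g \<in> fock_space" "h \<in> fock_space"
      by (auto simp: adjoint_pair_def)
    have "h w = of_real C * E g w" for w
    proof -
      \<comment> \<open>The operator maps a kernel to a multiple of another kernel, so testing an
        adjoint pair against it gives point evaluations of both \<open>g\<close> and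
        \<open>h\<close>.\<close>
      have "(\<lambda>z. of_real C * E (fock_kernel w) z)
          = (\<lambda>z. (of_real C * exp (cnj w * B)) * fock_kernel (of_real A * w + B) z)"
        by (simp add: E_def fock_kernel_def fun_eq_iff algebra_simps exp_add)
      moreover have "?T (fock_kernel w) = Some (\<lambda>z. of_real C * E (fock_kernel w) z)"
        using sub_dom[of "fock_kernel w"] subgaussian_exp_linear[of "cnj w"]
          fock_spaceD(1)[OF fock_kernel_in_fock_space] by (simp add: fock_kernel_def[abs_def])
      ultimately have "fock_inner (\<lambda>z. (of_real C * exp (cnj w * B)) * fock_kernel (of_real A * w + B) z) g
          = fock_inner (fock_kernel w) h"
        using * by (auto simp: adjoint_pair_def)
      then have "(of_real C * exp (cnj w * B)) * cnj (g (of_real A * w + B)) = cnj (h w)"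
        using g by (simp add: fock_inner_cmult_left fock_inner_commute[of "fock_kernel _"] fock_reproducing)
      from arg_cong[OF this, of cnj] show ?thesis
        by (simp add: E_def exp_cnj mult_ac)
    qed
    then have "h = (\<lambda>z. of_real C * E g z)" by auto
    with g show "?T g = Some h"
      by (simp add: W_max_def wc)
  qed
  have "op_adjoint ?T g = ?T g" for g
    unfolding op_adjoint_def pair by (cases "?T g") auto
  then have "?T = op_adjoint ?T" by (intro ext) simp
  ultimately show ?thesis
    unfolding hermitian_op_def using fock_operator_W_max closed_op_W_max by blast
qed

theorem theorem5p2:
  fixes \<psi> \<phi> :: "complex \<Rightarrow> complex"
  assumes "\<psi> holomorphic_on UNIV" and "\<phi> holomorphic_on UNIV"
    and "\<exists>z. \<psi> z \<noteq> 0"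
  shows "(hermitian_op (W_max \<psi> \<phi>) \<longleftrightarrow>
            densely_defined (W_max \<psi> \<phi>) \<and> op_adjoint (W_max \<psi> \<phi>) \<subseteq>\<^sub>m W_max \<psi> \<phi>) \<and>
         (densely_defined (W_max \<psi> \<phi>) \<and> op_adjoint (W_max \<psi> \<phi>) \<subseteq>\<^sub>m W_max \<psi> \<phi> \<longleftrightarrow>
            (\<exists>(A::real) (C::real) (B::complex). C \<noteq> 0 \<and>
               (\<forall>z. \<phi> z = of_real A * z + B) \<and>
               (\<forall>z. \<psi> z = of_real C * exp (cnj B * z))))"
    (is "(?H \<longleftrightarrow> ?D) \<and> (?D \<longleftrightarrow> ?F)")
proof -
  have "?H \<Longrightarrow> ?D"
  proof
    assume ?H
    then have eq: "W_max \<psi> \<phi> = op_adjoint (W_max \<psi> \<phi>)" and dense: "densely_defined (W_max \<psi> \<phi>)"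
      unfolding hermitian_op_def by blast+
    show "op_adjoint (W_max \<psi> \<phi>) \<subseteq>\<^sub>m W_max \<psi> \<phi>"
      \<comment> \<open>Only the left occurrence of the operator is replaced, which reduces the
        claim to reflexivity.\<close>
      by (rule subst[where P = "\<lambda>X. X \<subseteq>\<^sub>m W_max \<psi> \<phi>", OF eq]) (rule map_le_refl)
    show "densely_defined (W_max \<psi> \<phi>)" by (rule dense)
  qed
  moreover have "?D \<Longrightarrow> ?F"
    by (rule kernel_identity_imp_form[OF assms(2,3)], rule adjoint_extended_imp_kernel_identity) simp_all
  moreover have "?F \<Longrightarrow> ?H"
    using affine_imp_hermitian by blast
  ultimately show ?thesis by blast
qed

end
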